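(* Let $c>0$, $\theta\ge 0$, $\alpha,\beta\in(0,1)$ and $\gamma>0$ be fixed. For each $N$ let $\mu_N$ be an arbitrary probability measure on $\Omega_N=\{0,1\}^{\{1,\dots,N-1\}}$, except that in the case $\theta>1$ and $0<\gamma\le\theta-1$ we additionally assume that there exists $m_0\in[0,1]$ such that $$\lim_{N\to\infty}E_{\mu_N}\Big[\Big|\frac1{N-1}\sum_{x=1}^{N-1}\eta(x)-m_0\Big|\Big]=0 .$$ Let $(\eta^N_t)_{t\ge0}$ be the continuous-time Markov chain on $\Omega_N$ with generator $N^{2+\gamma}L_N$ and initial law $\mu_N$ (symmetric simple exclusion process with slow boundary, see context), with expectation $\mathbb{E}^N_{\mu_N}$, and for $G\in C[0,1]$ put $\langle\pi^N_t,G\rangle=\frac1N\sum_{x=1}^{N-1}\eta^N_t(x)\,G(x/N)$. Then for every $t>0$ and every $G\in C[0,1]$, $$\lim_{N\to\infty}\mathbb{E}^N_{\mu_N}\Big[\Big|\int_0^t\Big\{\langle\pi^N_s,G\rangle-\int_0^1\rho_{\theta,\gamma}(s,u)\,G(u)\,du\Big\}\,ds\Big|\Big]=0,$$ where $$\rho_{\theta,\gamma}(t,u)=\begin{cases}(\beta-\alpha)u+\alpha, & 0\le\theta<1,\\[2pt] \dfrac{c(\beta-\alpha)}{2+c}\,u+\alpha+\dfrac{\beta-\alpha}{2+c}, & \theta=1,\\[6pt] m_0, & \theta>1,\ 0<\gamma<\theta-1,\\[2pt] \dfrac{\alpha+\beta}{2}, & \theta>1,\ \gamma>\theta-1,\\[6pt]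 \dfrac{\alpha+\beta}{2}+\Big(m_0-\dfrac{\alpha+\beta}{2}\Big)e^{-2ct}, & \theta>1,\ \gamma=\theta-1.\end{cases}$$
   Context: State space: $\Omega_N=\{0,1\}^{I_N}$ with $I_N=\{1,\dots,N-1\}$; $\eta(x)=1$ means that site $x$ is occupied. For $\eta\in\Omega_N$, $\eta^{x,y}$ denotes the configuration obtained from $\eta$ by exchanging the values at $x$ and $y$, and $\eta^x$ the configuration obtained by replacing $\eta(x)$ by $1-\eta(x)$. Generator: for $f:\Omega_N\to\mathbb{R}$, $L_N=L_{N,0}+L^\alpha_{N,b}+L^\beta_{N,b}$ with $$(L_{N,0}f)(\eta)=\sum_{x=1}^{N-2}[f(\eta^{x,x+1})-f(\eta)],$$ $$(L^\alpha_{N,b}f)(\eta)=cN^{-\theta}r_\alpha(\eta)[f(\eta^1)-f(\eta)],\qquad (L^\beta_{N,b}f)(\eta)=cN^{-\theta}r_\beta(\eta)[f(\eta^{N-1})-f(\eta)],$$ where $r_\alpha(\eta)=\alpha(1-\eta(1))+(1-\alpha)\eta(1)$ and $r_\beta(\eta)=\beta(1-\eta(N-1))+(1-\beta)\eta(N-1)$. $E_{\mu_N}$ is expectation with respect to $\mu_N$; $\mathbb{E}^N_{\mu_N}$ is expectation with respect to the law on the path space $D([0,\infty),\Omega_N)$ of the chain with generator $N^{2+\gamma}L_N$ started from $\mu_N$. *)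

theory Defs
  imports "HOL-Probability.Probability"
begin

type_synonym config = "nat \<Rightarrow> nat"

definition sites :: "nat \<Rightarrow> nat set" where
  "sites N = {1..N - 1}"

definition configs :: "nat \<Rightarrow> config set" where
  "configs N = sites N \<rightarrow>\<^sub>E {0, 1}"

definition exchange :: "nat \<Rightarrow> nat \<Rightarrow> config \<Rightarrow> config" where
  "exchange x y \<eta> = \<eta>(x := \<eta> y, y := \<eta> x)"

definition flip :: "nat \<Rightarrow> config \<Rightarrow> config" where
  "flip x \<eta> = \<eta>(x := 1 - \<eta> x)"

text \<open>For \<open>N \<ge> 2\<close> all moves below map \<open>configs N\<close> into itself. For \<open>N \<le> 1\<close> there are no
  sites, and the boundary operators, which act on the sites \<open>1\<close> and \<open>N - 1\<close>, are meaningless.\<close>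

definition gen_bulk :: "nat \<Rightarrow> (config \<Rightarrow> real) \<Rightarrow> config \<Rightarrow> real" where
  "gen_bulk N f \<eta> = (\<Sum>x = 1..N - 2. f (exchange x (x + 1) \<eta>) - f \<eta>)"

definition boundary_rate :: "real \<Rightarrow> nat \<Rightarrow> config \<Rightarrow> real" where
  "boundary_rate a x \<eta> = a * (1 - real (\<eta> x)) + (1 - a) * real (\<eta> x)"

definition gen_boundary ::
    "real \<Rightarrow> real \<Rightarrow> nat \<Rightarrow> real \<Rightarrow> nat \<Rightarrow> (config \<Rightarrow> real) \<Rightarrow> config \<Rightarrow> real" where
  "gen_boundary c \<theta> N a x f \<eta> =
     c * real N powr (- \<theta>) * boundary_rate a x \<eta> * (f (flip x \<eta>) - f \<eta>)"

definition gen_ssep ::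
    "real \<Rightarrow> real \<Rightarrow> real \<Rightarrow> real \<Rightarrow> nat \<Rightarrow> (config \<Rightarrow> real) \<Rightarrow> config \<Rightarrow> real" where
  "gen_ssep c \<theta> \<alpha> \<beta> N f \<eta> =
     gen_bulk N f \<eta> + gen_boundary c \<theta> N \<alpha> 1 f \<eta> + gen_boundary c \<theta> N \<beta> (N - 1) f \<eta>"

definition gen_accelerated ::
    "real \<Rightarrow> real \<Rightarrow> real \<Rightarrow> real \<Rightarrow> real \<Rightarrow> nat \<Rightarrow> (config \<Rightarrow> real) \<Rightarrow> config \<Rightarrow> real" where
  "gen_accelerated c \<theta> \<alpha> \<beta> \<gamma> N f \<eta> = real N powr (2 + \<gamma>) * gen_ssep c \<theta> \<alpha> \<beta> N f \<eta>"

text \<open>The semigroup \<open>exp (t L)\<close> generated by \<open>L\<close>; the series converges on \<open>S\<close> whenever \<open>L\<close> is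
  linear and \<open>L f\<close> restricted to the finite set \<open>S\<close> depends only on the values of \<open>f\<close> on \<open>S\<close>.\<close>

definition semigroup_of ::
    "(('s \<Rightarrow> real) \<Rightarrow> 's \<Rightarrow> real) \<Rightarrow> real \<Rightarrow> ('s \<Rightarrow> real) \<Rightarrow> 's \<Rightarrow> real" where
  "semigroup_of L t f x = (\<Sum>k. t ^ k / fact k * (L ^^ k) f x)"

definition transition_prob ::
    "(('s \<Rightarrow> real) \<Rightarrow> 's \<Rightarrow> real) \<Rightarrow> real \<Rightarrow> 's \<Rightarrow> 's \<Rightarrow> real" where
  "transition_prob L t x y = semigroup_of L t (indicator {y}) x"

text \<open>Right-continuity and existence of left limits, for the discrete topology on the state
  space.\<close>

definition cadlag_path :: "(real \<Rightarrow> 's) \<Rightarrow> bool" where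
  "cadlag_path p \<longleftrightarrow>
     (\<forall>t\<ge>0. eventually (\<lambda>s. p s = p t) (at_right t)) \<and>
     (\<forall>t>0. \<exists>y. eventually (\<lambda>s. p s = y) (at_left t))"

text \<open>\<open>X\<close>, defined on the probability space \<open>M\<close>, is a continuous-time Markov chain on \<open>S\<close> with
  generator \<open>L\<close> and initial law \<open>\<mu>\<close>. Together with the regularity of the paths, the
  finite-dimensional distributions determine the law of \<open>X\<close> on the path space.\<close>

definition ctmc ::
    "'s set \<Rightarrow> (('s \<Rightarrow> real) \<Rightarrow> 's \<Rightarrow> real) \<Rightarrow> 's pmf \<Rightarrow> 'w measure \<Rightarrow> (real \<Rightarrow> 'w \<Rightarrow> 's) \<Rightarrow> bool"
  where
  "ctmc S L \<mu> M X \<longleftrightarrow>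
     prob_space M \<and>
     (\<forall>t\<ge>0. X t \<in> measurable M (count_space S)) \<and>
     (\<forall>\<omega>\<in>space M. cadlag_path (\<lambda>t. X t \<omega>)) \<and>
     (\<forall>(n::nat) (\<tau> :: nat \<Rightarrow> real) \<xi>.
        \<tau> 0 = 0 \<and> (\<forall>i<n. \<tau> i \<le> \<tau> (Suc i)) \<and> (\<forall>i\<le>n. \<xi> i \<in> S) \<longrightarrow>
        measure M {\<omega> \<in> space M. \<forall>i\<le>n. X (\<tau> i) \<omega> = \<xi> i} =
          pmf \<mu> (\<xi> 0) *
          (\<Prod>i<n. transition_prob L (\<tau> (Suc i) - \<tau> i) (\<xi> i) (\<xi> (Suc i))))"

definition empirical_pairing :: "nat \<Rightarrow> config \<Rightarrow> (real \<Rightarrow> real) \<Rightarrow> real" where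
  "empirical_pairing N \<eta> G = (\<Sum>x\<in>sites N. real (\<eta> x) * G (real x / real N)) / real N"

definition mean_density :: "nat \<Rightarrow> config \<Rightarrow> real" where
  "mean_density N \<eta> = (\<Sum>x\<in>sites N. real (\<eta> x)) / real (N - 1)"

text \<open>The branches are exhaustive for \<open>\<theta> \<ge> 0\<close>; the last one is \<open>\<theta> > 1\<close>, \<open>\<gamma> = \<theta> - 1\<close>. The value
  \<open>m\<^sub>0\<close> is used only if \<open>\<theta> > 1\<close> and \<open>\<gamma> \<le> \<theta> - 1\<close>.\<close>

definition profile ::
    "real \<Rightarrow> real \<Rightarrow> real \<Rightarrow> real \<Rightarrow> real \<Rightarrow> real \<Rightarrow> real \<Rightarrow> real \<Rightarrow> real" where
  "profile c \<theta> \<alpha> \<beta> \<gamma> m\<^sub>0 t u =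
     (if \<theta> < 1 then (\<beta> - \<alpha>) * u + \<alpha>
      else if \<theta> = 1 then c * (\<beta> - \<alpha>) / (2 + c) * u + \<alpha> + (\<beta> - \<alpha>) / (2 + c)
      else if \<gamma> < \<theta> - 1 then m\<^sub>0
      else if \<gamma> > \<theta> - 1 then (\<alpha> + \<beta>) / 2
      else (\<alpha> + \<beta>) / 2 + (m\<^sub>0 - (\<alpha> + \<beta>) / 2) * exp (- 2 * c * t))"

end

theory Submission
  imports Defs "HOL-Real_Asymp.Real_Asymp"
begin

text \<open>Occupation numbers solve closed equations: the generator maps every linear function
\<open>\<Sum>x. h x * \<eta> x\<close> to an affine function of \<open>\<eta>\<close>, namely the discrete Laplacian of \<open>h\<close> with Robin
conditions at the two ends. So time averages can be computed by solving a one-dimensional discrete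
Poisson equation.

Let \<open>L\<close> be the accelerated generator, \<open>K = N powr (2 + \<gamma>)\<close> and \<open>\<kappa> = c * N powr (- \<theta>)\<close>. If
\<open>L F = V\<close>, the Markov property turns the two-time correlations into
\<open>\<integral>\<^sub>r\<^sup>t E[V(X\<^sub>r) V(X\<^sub>s)] ds = E[V(X\<^sub>r) (F(X\<^sub>t) - F(X\<^sub>r))]\<close>, and hence the second moment of
\<open>\<integral>\<^sub>0\<^sup>t V(X\<^sub>s) ds\<close> is at most \<open>4 * t * sup \<bar>V\<bar> * sup \<bar>F\<bar>\<close> (\<open>time_integral_second_moment\<close>,
\<open>time_average_bound\<close>). The factor \<open>1 / K\<close> in \<open>F\<close> makes \<open>sup \<bar>F\<bar>\<close> small.

If \<open>\<gamma> > \<theta> - 1\<close>, which covers \<open>\<theta> \<le> 1\<close>, the Robin problem for the sampled test function has a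
solution of size \<open>O(N + N powr \<theta>)\<close> (\<open>robin_poisson_solution\<close>); summed over the sites and divided
by \<open>K\<close> it is \<open>O(N powr (- \<gamma>) + N powr (\<theta> - 1 - \<gamma>))\<close>, which vanishes. Therefore the empirical
pairing averages in time to its value under the affine stationary profile, whose limit is the
profile of the theorem (\<open>stationary_pairing_limit\<close>).

If \<open>\<theta> > 1\<close> and \<open>\<gamma> \<le> \<theta> - 1\<close>, the constant mode of the Robin problem relaxes too slowly. The
Neumann problem is still good enough for test functions of mean zero
(\<open>slow_boundary_fluctuation\<close>), so only the total mass matters. Its drift involves the occupation
of the two end sites; adding to the mean density a small linear correction, an explicit parabola,
replaces them by the mean density itself, exactly (\<open>corrected_mass\<close>). The corrected mass \<open>Q\<close>
thus obeys, up to vanishing errors, a linear relaxation equation with rate \<open>2 * c\<close> if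
\<open>\<gamma> = \<theta> - 1\<close> and \<open>0\<close> if \<open>\<gamma> < \<theta> - 1\<close>; its carre du champ vanishes as well, so the same holds
for \<open>Q\<^sup>2\<close>, and \<open>Q\<close> follows the deterministic solution in \<open>L\<^sup>2\<close>
(\<open>relaxation_second_moment\<close>, \<open>slow_boundary_mass\<close>).\<close>

section \<open>Semigroups of bounded generators on finite sets\<close>

text \<open>The operator acts on functions on the whole type, although only the values on \<open>S\<close> are meaningful.
The bound for \<open>B = 0\<close> says that \<open>L f\<close> on \<open>S\<close> depends only on \<open>f\<close> on \<open>S\<close>.\<close>

locale finite_generator =
  fixes S :: "'s set" and L :: "('s \<Rightarrow> real) \<Rightarrow> 's \<Rightarrow> real" and C :: real
  assumes finite_S: "finite S"
    and L_lin: "L (\<lambda>x. a * f x + b * g x) = (\<lambda>x. a * L f x + b * L g x)"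
    and L_bound: "(\<And>y. y \<in> S \<Longrightarrow> \<bar>f y\<bar> \<le> B) \<Longrightarrow> x \<in> S \<Longrightarrow> \<bar>L f x\<bar> \<le> C * B"
begin

lemma iterate_bound:
  assumes "\<And>y. y \<in> S \<Longrightarrow> \<bar>f y\<bar> \<le> B" "x \<in> S"
  shows "\<bar>(L ^^ k) f x\<bar> \<le> C ^ k * B"
  using assms(2)
proof (induction k arbitrary: x)
  case 0
  then show ?case using assms(1) by simp
next
  case (Suc k)
  have "\<bar>L ((L ^^ k) f) x\<bar> \<le> C * (C ^ k * B)"
    using Suc by (intro L_bound) auto
  then show ?case by (simp add: mult_ac)
qed

lemma iterate_lin:
  "(L ^^ k) (\<lambda>x. a * f x + b * g x) = (\<lambda>x. a * (L ^^ k) f x + b * (L ^^ k) g x)"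
  by (induction k) (simp_all add: L_lin)

lemma iterate_zero: "(L ^^ k) (\<lambda>x. 0) = (\<lambda>x. 0)"
  using iterate_lin[of k 0 "\<lambda>x. 0" 0 "\<lambda>x. 0"] by simp

lemma iterate_sum:
  "finite T \<Longrightarrow> (L ^^ k) (\<lambda>x. \<Sum>y\<in>T. a y * f y x) = (\<lambda>x. \<Sum>y\<in>T. a y * (L ^^ k) (f y) x)"
proof (induction T rule: finite_induct)
  case empty
  then show ?case by (simp add: iterate_zero)
next
  case (insert z T)
  have "(L ^^ k) (\<lambda>x. \<Sum>y\<in>insert z T. a y * f y x)
      = (L ^^ k) (\<lambda>x. a z * f z x + 1 * (\<Sum>y\<in>T. a y * f y x))"
    using insert by simp
  also have "\<dots> = (\<lambda>x. a z * (L ^^ k) (f z) x + 1 * (L ^^ k) (\<lambda>x. \<Sum>y\<in>T. a y * f y x) x)"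
    by (rule iterate_lin)
  finally show ?case using insert by simp
qed

text \<open>\<open>f\<close> and its expansion into indicators agree on \<open>S\<close>, and the bound with \<open>B = 0\<close> makes iterates blind
to their difference elsewhere.\<close>

lemma iterate_expand:
  assumes "x \<in> S"
  shows "(L ^^ k) f x = (\<Sum>y\<in>S. f y * (L ^^ k) (indicator {y}) x)"
proof -
  let ?g = "\<lambda>z. \<Sum>y\<in>S. f y * indicator {y} z"
  have eq: "?g z = f z" if "z \<in> S" for z
    using that finite_S by (simp add: indicator_def sum.delta if_distrib cong: if_cong)
  have "\<bar>(L ^^ k) (\<lambda>x. 1 * f x + (-1) * ?g x) x\<bar> \<le> C ^ k * 0"
    by (rule iterate_bound) (use eq assms in auto)
  then have "(L ^^ k) f x = (L ^^ k) ?g x"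
    unfolding iterate_lin by simp
  also have "\<dots> = (\<Sum>y\<in>S. f y * (L ^^ k) (indicator {y}) x)"
    by (subst iterate_sum[OF finite_S]) simp
  finally show ?thesis .
qed

lemma bounded_on_S: "\<exists>B. \<forall>y\<in>S. \<bar>f y :: real\<bar> \<le> B"
proof -
  have "bdd_above ((\<lambda>y. \<bar>f y\<bar>) ` S)" using finite_S by simp
  then show ?thesis by (auto simp: bdd_above_def)
qed

lemma semigroup_summable:
  assumes "x \<in> S"
  shows "summable (\<lambda>k. (L ^^ k) f x / fact k * t ^ k)"
proof -
  obtain B where B: "\<And>y. y \<in> S \<Longrightarrow> \<bar>f y\<bar> \<le> B" using bounded_on_S by blast
  have "summable (\<lambda>k. B * ((C * \<bar>t\<bar>) ^ k / fact k))"
    by (intro summable_mult) (use summable_exp[of "C * \<bar>t\<bar>"] in \<open>simp add: field_simps\<close>)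
  then show ?thesis
  proof (rule summable_comparison_test'[where N=0])
    fix k :: nat assume "k \<ge> 0"
    have "\<bar>(L ^^ k) f x\<bar> * \<bar>t\<bar> ^ k \<le> C ^ k * B * \<bar>t\<bar> ^ k"
      using iterate_bound[of f B x k] B assms by (intro mult_right_mono) auto
    then show "norm ((L ^^ k) f x / fact k * t ^ k) \<le> B * ((C * \<bar>t\<bar>) ^ k / fact k)"
      by (simp add: abs_mult power_abs power_mult_distrib field_simps)
  qed
qed

lemma semigroup_series: "semigroup_of L t f x = (\<Sum>k. (L ^^ k) f x / fact k * t ^ k)"
  unfolding semigroup_of_def by (simp add: field_simps)

text \<open>Termwise differentiation of the power series shifts the coefficients by one, which is the same as
replacing \<open>f\<close> by \<open>L f\<close>.\<close>

lemma semigroup_derivative: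
  assumes "x \<in> S"
  shows "((\<lambda>t. semigroup_of L t f x) has_real_derivative semigroup_of L t (L f) x) (at t)"
proof -
  let ?c = "\<lambda>k. (L ^^ k) f x / fact k"
  have "((\<lambda>t. \<Sum>k. ?c k * t ^ k) has_real_derivative (\<Sum>k. diffs ?c k * t ^ k)) (at t)"
    by (rule termdiffs_strong_converges_everywhere) (use semigroup_summable[OF assms] in auto)
  moreover have "diffs ?c = (\<lambda>k. (L ^^ k) (L f) x / fact k)"
    by (rule ext) (simp add: diffs_def funpow_swap1 del: funpow.simps, simp add: funpow_swap1 field_simps)
  ultimately show ?thesis unfolding semigroup_series by simp
qed

lemma semigroup_transition:
  assumes "x \<in> S"
  shows "(\<Sum>y\<in>S. transition_prob L t x y * f y) = semigroup_of L t f x"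
proof -
  have "(\<Sum>y\<in>S. transition_prob L t x y * f y)
     = (\<Sum>y\<in>S. \<Sum>k. (L ^^ k) (indicator {y}) x / fact k * t ^ k * f y)"
    unfolding transition_prob_def semigroup_series
    using semigroup_summable[OF assms]
    by (intro sum.cong refl suminf_mult2) auto
  also have "\<dots> = (\<Sum>k. \<Sum>y\<in>S. (L ^^ k) (indicator {y}) x / fact k * t ^ k * f y)"
    by (rule suminf_sum[symmetric]) (intro summable_mult2 semigroup_summable[OF assms])
  also have "\<dots> = semigroup_of L t f x"
    unfolding semigroup_series iterate_expand[OF assms, of _ f]
    by (simp add: sum_divide_distrib sum_distrib_right sum_distrib_left mult_ac)
  finally show ?thesis .
qed

end

section \<open>Two-time correlations of a finite Markov chain\<close>

locale finite_ctmc = finite_generator S L C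
  for S :: "'s set" and L C +
  fixes \<mu> :: "'s pmf" and M :: "'w measure" and X :: "real \<Rightarrow> 'w \<Rightarrow> 's"
  assumes chain: "ctmc S L \<mu> M X" and initial: "set_pmf \<mu> \<subseteq> S"
begin

sublocale prob_space M
  using chain by (simp add: ctmc_def)

lemma X_measurable: "t \<ge> 0 \<Longrightarrow> X t \<in> measurable M (count_space S)"
  using chain by (simp add: ctmc_def)

lemma X_in_S: "t \<ge> 0 \<Longrightarrow> \<omega> \<in> space M \<Longrightarrow> X t \<omega> \<in> S"
  using measurable_space[OF X_measurable] by auto

lemma obs_measurable [measurable]: "t \<ge> 0 \<Longrightarrow> (\<lambda>\<omega>. f (X t \<omega>)) \<in> borel_measurable M" for f :: "'s \<Rightarrow> real"
  by (rule measurable_compose[OF X_measurable]) auto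

lemma events_X [measurable]: "t \<ge> 0 \<Longrightarrow> {\<omega>\<in>space M. X t \<omega> = \<xi>} \<in> events"
proof -
  assume "t \<ge> 0"
  then have "(\<lambda>\<omega>. indicator {\<xi>} (X t \<omega>) :: real) \<in> borel_measurable M" by simp
  then have "{\<omega>\<in>space M. indicator {\<xi>} (X t \<omega>) = (1::real)} \<in> events" by measurable
  then show ?thesis by (simp add: indicator_def)
qed

lemma path_cadlag: "\<omega> \<in> space M \<Longrightarrow> cadlag_path (\<lambda>t. X t \<omega>)"
  using chain by (simp add: ctmc_def)

lemma joint_law:
  assumes "0 \<le> r" "r \<le> s" "x \<in> S" "y \<in> S" "z \<in> S"
  shows "prob {\<omega>\<in>space M. X 0 \<omega> = x \<and> X r \<omega> = y \<and> X s \<omega> = z}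
    = pmf \<mu> x * transition_prob L r x y * transition_prob L (s - r) y z"
proof -
  define \<tau> where "\<tau> = (\<lambda>i::nat. if i = 0 then 0 else if i = 1 then r else s)"
  define \<xi> where "\<xi> = (\<lambda>i::nat. if i = 0 then x else if i = 1 then y else z)"
  have "\<forall>(n::nat) (\<tau> :: nat \<Rightarrow> real) \<xi>.
        \<tau> 0 = 0 \<and> (\<forall>i<n. \<tau> i \<le> \<tau> (Suc i)) \<and> (\<forall>i\<le>n. \<xi> i \<in> S) \<longrightarrow>
        measure M {\<omega> \<in> space M. \<forall>i\<le>n. X (\<tau> i) \<omega> = \<xi> i} =
          pmf \<mu> (\<xi> 0) *
          (\<Prod>i<n. transition_prob L (\<tau> (Suc i) - \<tau> i) (\<xi> i) (\<xi> (Suc i)))"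
    using chain unfolding ctmc_def by blast
  from this[rule_format, of \<tau> 2 \<xi>]
  have "measure M {\<omega> \<in> space M. \<forall>i\<le>2. X (\<tau> i) \<omega> = \<xi> i} =
          pmf \<mu> (\<xi> 0) * (\<Prod>i<2. transition_prob L (\<tau> (Suc i) - \<tau> i) (\<xi> i) (\<xi> (Suc i)))"
    using assms by (auto simp: \<tau>_def \<xi>_def)
  moreover have "{\<omega> \<in> space M. \<forall>i\<le>2. X (\<tau> i) \<omega> = \<xi> i}
    = {\<omega>\<in>space M. X 0 \<omega> = x \<and> X r \<omega> = y \<and> X s \<omega> = z}"
    by (auto simp: \<tau>_def \<xi>_def numeral_2_eq_2 le_Suc_eq)
  ultimately show ?thesis by (simp add: \<tau>_def \<xi>_def numeral_2_eq_2 mult_ac)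
qed

lemma initial_law: "expectation (\<lambda>\<omega>. f (X 0 \<omega>)) = measure_pmf.expectation \<mu> f" for f :: "'s \<Rightarrow> real"
proof -
  have "prob {\<omega>\<in>space M. X 0 \<omega> = x} = pmf \<mu> x" if "x \<in> S" for x
  proof -
    have "\<forall>(n::nat) (\<tau> :: nat \<Rightarrow> real) \<xi>.
        \<tau> 0 = 0 \<and> (\<forall>i<n. \<tau> i \<le> \<tau> (Suc i)) \<and> (\<forall>i\<le>n. \<xi> i \<in> S) \<longrightarrow>
        measure M {\<omega> \<in> space M. \<forall>i\<le>n. X (\<tau> i) \<omega> = \<xi> i} =
          pmf \<mu> (\<xi> 0) *
          (\<Prod>i<n. transition_prob L (\<tau> (Suc i) - \<tau> i) (\<xi> i) (\<xi> (Suc i)))"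
      using chain unfolding ctmc_def by blast
    from this[rule_format, of "\<lambda>_. 0" 0 "\<lambda>_. x"] show ?thesis using that by simp
  qed
  moreover have "expectation (\<lambda>\<omega>. f (X 0 \<omega>))
     = expectation (\<lambda>\<omega>. \<Sum>x\<in>S. f x * indicator {\<omega>\<in>space M. X 0 \<omega> = x} \<omega>)"
    using X_in_S[of 0] finite_S
    by (intro Bochner_Integration.integral_cong)
       (auto simp: indicator_def sum.delta if_distrib cong: if_cong)
  moreover have "\<dots> = (\<Sum>x\<in>S. f x * prob {\<omega>\<in>space M. X 0 \<omega> = x})"
    by (subst Bochner_Integration.integral_sum) (auto intro!: integrable_mult_right integrable_real_indicator simp: emeasure_eq_measure)
  ultimately show ?thesis
    using integral_measure_pmf_real[OF finite_S, of \<mu> f] initial by (simp add: subset_iff)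
qed

text \<open>The weights \<open>w\<close> are the law of \<open>X r\<close> multiplied by \<open>f\<close>. What matters is only that they do not
depend on \<open>s\<close> or \<open>g\<close>, so that all of the dependence on \<open>s\<close> sits in the semigroup.\<close>

lemma two_time_expectation:
  assumes "0 \<le> r"
  obtains w where "\<And>g s. r \<le> s \<Longrightarrow>
    expectation (\<lambda>\<omega>. f (X r \<omega>) * g (X s \<omega>)) = (\<Sum>y\<in>S. w y * semigroup_of L (s - r) g y)"
proof -
  define w where "w y = (\<Sum>x\<in>S. pmf \<mu> x * transition_prob L r x y) * f y" for y
  have "expectation (\<lambda>\<omega>. f (X r \<omega>) * g (X s \<omega>)) = (\<Sum>y\<in>S. w y * semigroup_of L (s - r) g y)"
    if "r \<le> s" for g s
  proof -
    let ?A = "\<lambda>x y z. {\<omega>\<in>space M. X 0 \<omega> = x \<and> X r \<omega> = y \<and> X s \<omega> = z}"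
    have A: "?A x y z \<in> events" for x y z
    proof -
      have "?A x y z = {\<omega>\<in>space M. X 0 \<omega> = x} \<inter> {\<omega>\<in>space M. X r \<omega> = y} \<inter> {\<omega>\<in>space M. X s \<omega> = z}"
        by auto
      then show ?thesis using assms that by auto
    qed
    have "expectation (\<lambda>\<omega>. f (X r \<omega>) * g (X s \<omega>))
       = expectation (\<lambda>\<omega>. \<Sum>x\<in>S. \<Sum>y\<in>S. \<Sum>z\<in>S. f y * g z * indicator (?A x y z) \<omega>)"
    proof (intro Bochner_Integration.integral_cong refl)
      fix \<omega> assume \<omega>: "\<omega> \<in> space M"
      have in_S: "X 0 \<omega> \<in> S" "X r \<omega> \<in> S" "X s \<omega> \<in> S" using X_in_S \<omega> assms that by auto
      have "(\<Sum>x\<in>S. \<Sum>y\<in>S. \<Sum>z\<in>S. f y * g z * indicator (?A x y z) \<omega>)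
         = (\<Sum>x\<in>S. \<Sum>y\<in>S. \<Sum>z\<in>S. if z = X s \<omega> then (if y = X r \<omega> then (if x = X 0 \<omega> then f y * g z else 0) else 0) else 0)"
        using \<omega> by (intro sum.cong refl) (auto simp: indicator_def)
      also have "\<dots> = f (X r \<omega>) * g (X s \<omega>)"
        using in_S finite_S by (simp add: sum.delta)
      finally show "f (X r \<omega>) * g (X s \<omega>) = (\<Sum>x\<in>S. \<Sum>y\<in>S. \<Sum>z\<in>S. f y * g z * indicator (?A x y z) \<omega>)"
        by simp
    qed
    also have "\<dots> = (\<Sum>x\<in>S. \<Sum>y\<in>S. \<Sum>z\<in>S. f y * g z * prob (?A x y z))"
      using A by (simp add: Bochner_Integration.integral_sum emeasure_eq_measure integrable_real_indicator)
    also have "\<dots> = (\<Sum>x\<in>S. \<Sum>y\<in>S. \<Sum>z\<in>S. f y * g z * (pmf \<mu> x * transition_prob L r x y * transition_prob L (s - r) y z))"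
      using joint_law[OF assms that] by simp
    also have "\<dots> = (\<Sum>y\<in>S. \<Sum>x\<in>S. \<Sum>z\<in>S. f y * g z * (pmf \<mu> x * transition_prob L r x y * transition_prob L (s - r) y z))"
      by (rule sum.swap)
    also have "\<dots> = (\<Sum>y\<in>S. w y * (\<Sum>z\<in>S. transition_prob L (s - r) y z * g z))"
      unfolding w_def by (simp add: sum_distrib_left sum_distrib_right mult_ac)
    also have "\<dots> = (\<Sum>y\<in>S. w y * semigroup_of L (s - r) g y)"
      using semigroup_transition by simp
    finally show ?thesis .
  qed
  then show thesis by (rule that)
qed

text \<open>Dynkin's formula tested against the past: the derivative of the semigroup is averaged with
the weights of the previous lemma.\<close>

lemma dynkin_two_time:
  assumes "0 \<le> r" "r \<le> s"
  shows "((\<lambda>s. expectation (\<lambda>\<omega>. f (X r \<omega>) * g (X s \<omega>))) has_real_derivative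
    expectation (\<lambda>\<omega>. f (X r \<omega>) * L g (X s \<omega>))) (at s within {r..})"
proof -
  obtain w where w: "\<And>g s. r \<le> s \<Longrightarrow>
    expectation (\<lambda>\<omega>. f (X r \<omega>) * g (X s \<omega>)) = (\<Sum>y\<in>S. w y * semigroup_of L (s - r) g y)"
    using two_time_expectation[OF assms(1), of f] by blast
  have d: "((\<lambda>s. semigroup_of L (s - r) g y) has_real_derivative semigroup_of L (s - r) (L g) y)
      (at s within {r..})" if "y \<in> S" for y
  proof -
    have "((\<lambda>s. s - r) has_real_derivative 1) (at s within {r..})"
      by (auto intro!: derivative_eq_intros)
    from DERIV_chain2[OF semigroup_derivative[OF that, of g "s - r"] this] show ?thesis by simp
  qed
  have "((\<lambda>s. \<Sum>y\<in>S. w y * semigroup_of L (s - r) g y) has_real_derivative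
     (\<Sum>y\<in>S. w y * semigroup_of L (s - r) (L g) y)) (at s within {r..})"
    by (intro DERIV_sum DERIV_cmult d)
  then have "((\<lambda>s. expectation (\<lambda>\<omega>. f (X r \<omega>) * g (X s \<omega>))) has_real_derivative
     (\<Sum>y\<in>S. w y * semigroup_of L (s - r) (L g) y)) (at s within {r..})"
    by (rule has_field_derivative_transform_within[where d = 1]) (use assms w in auto)
  then show ?thesis
    using w[OF assms(2), of "L g"] by simp
qed

lemma dynkin:
  assumes "0 \<le> s"
  shows "((\<lambda>s. expectation (\<lambda>\<omega>. g (X s \<omega>))) has_real_derivative
    expectation (\<lambda>\<omega>. L g (X s \<omega>))) (at s within {0..})"
  using dynkin_two_time[of 0 s "\<lambda>_. 1" g] assms by simp

end

section \<open>Time integrals along the paths\<close>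

abbreviation horizon :: "real \<Rightarrow> real measure" where
  "horizon t \<equiv> restrict_space lborel {0..t}"

lemma set_integral_horizon: "(LBINT s:{0..t}. f s) = integral\<^sup>L (horizon t) f" for f :: "real \<Rightarrow> real"
  by (simp add: set_lebesgue_integral_def integral_restrict_space)

lemma space_horizon [simp]: "space (horizon t) = {0..t}"
  by (simp add: space_restrict_space)

lemma finite_horizon: "finite_measure (horizon t)"
proof (rule finite_measureI)
  have "emeasure lborel {0..t} \<noteq> \<infinity>" by (cases "0 \<le> t") auto
  then show "emeasure (horizon t) (space (horizon t)) \<noteq> \<infinity>" by (simp add: emeasure_restrict_space)
qed

lemma measure_horizon: "0 \<le> t \<Longrightarrow> measure (horizon t) {0..t} = t"
  by (simp add: measure_restrict_space)

text \<open>Nonnegativity of the variance of \<open>\<bar>Y\<bar>\<close>.\<close>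

lemma (in prob_space) abs_expectation_le_sqrt:
  fixes Y :: "'a \<Rightarrow> real"
  assumes "integrable M Y" "integrable M (\<lambda>\<omega>. (Y \<omega>)\<^sup>2)" "expectation (\<lambda>\<omega>. (Y \<omega>)\<^sup>2) \<le> D"
  shows "expectation (\<lambda>\<omega>. \<bar>Y \<omega>\<bar>) \<le> sqrt D"
proof -
  have "(expectation (\<lambda>\<omega>. \<bar>Y \<omega>\<bar>))\<^sup>2 \<le> expectation (\<lambda>\<omega>. \<bar>Y \<omega>\<bar>\<^sup>2)"
    using assms variance_positive[of "\<lambda>\<omega>. \<bar>Y \<omega>\<bar>"] variance_eq[of "\<lambda>\<omega>. \<bar>Y \<omega>\<bar>"] by simp
  also have "\<dots> \<le> D" using assms(3) by simp
  finally show ?thesis by (rule real_le_rsqrt)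
qed

context finite_ctmc
begin

lemma obs_bounded: "\<exists>B. \<forall>s\<ge>0. \<forall>\<omega>\<in>space M. \<bar>f (X s \<omega>)\<bar> \<le> (B::real)"
  using bounded_on_S[of f] X_in_S by blast

lemma obs_integrable [intro, simp]: "s \<ge> 0 \<Longrightarrow> integrable M (\<lambda>\<omega>. f (X s \<omega>))" for f :: "'s \<Rightarrow> real"
proof -
  assume s: "s \<ge> 0"
  obtain B where "\<forall>s\<ge>0. \<forall>\<omega>\<in>space M. \<bar>f (X s \<omega>)\<bar> \<le> B" using obs_bounded by blast
  with s show ?thesis by (intro integrable_const_bound[of _ B]) auto
qed

text \<open>A right-continuous path is the pointwise limit of the paths sampled at the next point of an ever
finer grid, and the sampled process is jointly measurable because the grid is countable. The sample
point must lie strictly to the right of \<open>s\<close>, hence the \<open>+ 1\<close> after the floor. Times are clipped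
at \<open>0\<close> because the chain lives on nonnegative times.\<close>

lemma jointly_measurable:
  "(\<lambda>p. f (X (max 0 (fst p)) (snd p)) :: real) \<in> borel_measurable (lborel \<Otimes>\<^sub>M M)"
proof (rule borel_measurable_LIMSEQ_real)
  let ?\<tau> = "\<lambda>k s::real. (of_int \<lfloor>real (Suc k) * max 0 s\<rfloor> + 1) / real (Suc k)"
  let ?Z = "\<lambda>k p. f (X (?\<tau> k (fst p)) (snd p))"
  show "(\<lambda>k. ?Z k p) \<longlonglongrightarrow> f (X (max 0 (fst p)) (snd p))"
    if "p \<in> space (lborel \<Otimes>\<^sub>M M)" for p
  proof -
    let ?s = "max 0 (fst p)"
    have up: "?s < ?\<tau> k (fst p)" for k
    proof -
      have "real (Suc k) * ?s < of_int \<lfloor>real (Suc k) * ?s\<rfloor> + 1" by linarith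
      then show ?thesis by (simp only: pos_less_divide_eq of_nat_0_less_iff zero_less_Suc mult.commute)
    qed
    have dn: "?\<tau> k (fst p) \<le> ?s + 1 / real (Suc k)" for k
    proof -
      have "of_int \<lfloor>real (Suc k) * ?s\<rfloor> + 1 \<le> real (Suc k) * ?s + 1" by linarith
      then have "?\<tau> k (fst p) \<le> (real (Suc k) * ?s + 1) / real (Suc k)"
        by (intro divide_right_mono) auto
      also have "\<dots> = ?s + 1 / real (Suc k)" by (simp add: add_divide_distrib)
      finally show ?thesis .
    qed
    have "(\<lambda>k. ?\<tau> k (fst p)) \<longlonglongrightarrow> ?s"
    proof (rule tendsto_sandwich[of "\<lambda>_. ?s" _ _ "\<lambda>k. ?s + 1 / real (Suc k)"])
      show "(\<lambda>k. ?s + 1 / real (Suc k)) \<longlonglongrightarrow> ?s"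
        using tendsto_add[OF tendsto_const[of ?s] LIMSEQ_inverse_real_of_nat] by (simp add: inverse_eq_divide)
      show "\<forall>\<^sub>F n in sequentially. ?s \<le> ?\<tau> n (fst p)"
        by (intro always_eventually allI less_imp_le up)
      show "\<forall>\<^sub>F n in sequentially. ?\<tau> n (fst p) \<le> ?s + 1 / real (Suc n)"
        by (intro always_eventually allI dn)
    qed (rule tendsto_const)
    then have "filterlim (\<lambda>k. ?\<tau> k (fst p)) (at_right ?s) sequentially"
      unfolding filterlim_at using less_imp_neq[OF up, symmetric] up
      by (intro conjI always_eventually allI) (simp_all only: greaterThan_iff not_False_eq_True UNIV_I)
    moreover have "\<forall>\<^sub>F s in at_right ?s. X s (snd p) = X ?s (snd p)"
      using path_cadlag[of "snd p"] that by (auto simp: cadlag_path_def space_pair_measure)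
    ultimately have "\<forall>\<^sub>F k in sequentially. X (?\<tau> k (fst p)) (snd p) = X ?s (snd p)"
      unfolding filterlim_iff by blast
    then have "\<forall>\<^sub>F k in sequentially. ?Z k p = f (X ?s (snd p))"
      by (rule eventually_mono) simp
    then show ?thesis by (rule tendsto_eventually)
  qed
  show "?Z k \<in> borel_measurable (lborel \<Otimes>\<^sub>M M)" for k
  proof -
    have "(\<lambda>p. (\<lambda>i p. f (X (max 0 ((of_int i + 1) / real (Suc k))) (snd p)))
          (\<lfloor>real (Suc k) * max 0 (fst p)\<rfloor>) p) \<in> borel_measurable (lborel \<Otimes>\<^sub>M M)"
    proof (rule measurable_compose_countable[where f = "\<lambda>i p. f (X (max 0 ((of_int i + 1) / real (Suc k))) (snd p))"])
      show "(\<lambda>p. f (X (max 0 ((of_int i + 1) / real (Suc k))) (snd p)))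
         \<in> borel_measurable (lborel \<Otimes>\<^sub>M M)" for i :: int
        by (rule measurable_compose[OF measurable_snd]) (rule obs_measurable, simp)
    qed measurable
    moreover have "max 0 ((of_int \<lfloor>real (Suc k) * max 0 (fst p)\<rfloor> + 1) / real (Suc k)) = ?\<tau> k (fst p)"
      for p :: "real \<times> 'w"
    proof -
      have "0 \<le> \<lfloor>real (Suc k) * max 0 (fst p)\<rfloor>" by simp
      then show ?thesis by (intro max_absorb2 divide_nonneg_nonneg) auto
    qed
    ultimately show ?thesis by simp
  qed
qed

lemma time_integral_max:
  "(LBINT s:{0..t}. f (X s \<omega>)) = (\<integral>s. f (X (max 0 s) \<omega>) \<partial>horizon t)" for f :: "'s \<Rightarrow> real"
  unfolding set_integral_horizon by (intro Bochner_Integration.integral_cong) auto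

lemma jointly_measurable_horizon:
  "(\<lambda>p. f (X (max 0 (fst p)) (snd p)) :: real) \<in> borel_measurable (horizon t \<Otimes>\<^sub>M M)"
proof -
  have "id \<in> measurable (horizon t) lborel"
    unfolding id_def by (rule measurable_restrict_space1) simp
  then have "(\<lambda>p. (fst p, snd p)) \<in> measurable (horizon t \<Otimes>\<^sub>M M) (lborel \<Otimes>\<^sub>M M)"
    by (intro measurable_Pair) (auto simp: id_def intro: measurable_compose[OF measurable_fst])
  from measurable_compose[OF this jointly_measurable[of f]] show ?thesis by simp
qed

lemma path_measurable:
  "\<omega> \<in> space M \<Longrightarrow> (\<lambda>s. f (X (max 0 s) \<omega>) :: real) \<in> borel_measurable (horizon t)"
  using measurable_compose[OF measurable_Pair2' jointly_measurable_horizon[of f t]]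
  by (auto simp: o_def)

lemma path_integrable:
  assumes "\<omega> \<in> space M"
  shows "integrable (horizon t) (\<lambda>s. f (X (max 0 s) \<omega>) :: real)"
proof -
  obtain B where "\<forall>s\<ge>0. \<forall>\<omega>\<in>space M. \<bar>f (X s \<omega>)\<bar> \<le> B" using obs_bounded by blast
  then show ?thesis
    using assms by (intro finite_measure.integrable_const_bound[OF finite_horizon, of _ B] path_measurable) auto
qed

lemma time_integral_measurable [measurable]:
  "(\<lambda>\<omega>. LBINT s:{0..t}. f (X s \<omega>)) \<in> borel_measurable M" for f :: "'s \<Rightarrow> real"
proof -
  interpret H: finite_measure "horizon t" by (rule finite_horizon)
  have "(\<lambda>\<omega>. \<integral>s. f (X (max 0 s) \<omega>) \<partial>horizon t) \<in> borel_measurable M"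
    by (rule H.borel_measurable_lebesgue_integral)
       (use measurable_compose[OF measurable_pair_swap' jointly_measurable_horizon[of f t]] in
         \<open>simp add: split_beta'\<close>)
  then show ?thesis unfolding time_integral_max .
qed

lemma time_integral_le:
  assumes "0 \<le> t" "\<omega> \<in> space M" "\<And>x. x \<in> S \<Longrightarrow> \<bar>f x\<bar> \<le> B"
  shows "\<bar>LBINT s:{0..t}. f (X s \<omega>)\<bar> \<le> t * B"
proof -
  interpret H: finite_measure "horizon t" by (rule finite_horizon)
  have "\<bar>\<integral>s. f (X (max 0 s) \<omega>) \<partial>horizon t\<bar> \<le> (\<integral>s. \<bar>f (X (max 0 s) \<omega>)\<bar> \<partial>horizon t)"
    by (rule integral_abs_bound)
  also have "\<dots> \<le> (\<integral>s. B \<partial>horizon t)"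
    using assms X_in_S by (intro integral_mono integrable_abs path_integrable) auto
  also have "\<dots> = t * B" using assms by (simp add: measure_horizon)
  finally show ?thesis unfolding time_integral_max .
qed

lemma time_integral_integrable [intro]:
  "0 \<le> t \<Longrightarrow> integrable M (\<lambda>\<omega>. LBINT s:{0..t}. f (X s \<omega>))" for f :: "'s \<Rightarrow> real"
proof -
  assume "0 \<le> t"
  obtain B where "\<forall>y\<in>S. \<bar>f y\<bar> \<le> B" using bounded_on_S by blast
  then show ?thesis
    using time_integral_le[OF \<open>0 \<le> t\<close>, of _ f B] by (intro integrable_const_bound[of _ "t * B"]) auto
qed

lemma expectation_le:
  fixes f g :: "'s \<Rightarrow> real"
  assumes "0 \<le> r" "0 \<le> s" "\<And>x. x \<in> S \<Longrightarrow> \<bar>f x\<bar> \<le> Bf" "\<And>x. x \<in> S \<Longrightarrow> \<bar>g x\<bar> \<le> Bg"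
  shows "\<bar>expectation (\<lambda>\<omega>. f (X r \<omega>) * g (X s \<omega>))\<bar> \<le> Bf * Bg"
proof -
  have b: "\<bar>f (X r \<omega>) * g (X s \<omega>)\<bar> \<le> Bf * Bg" if "\<omega> \<in> space M" for \<omega>
  proof -
    have "\<bar>f (X r \<omega>)\<bar> \<le> Bf" "\<bar>g (X s \<omega>)\<bar> \<le> Bg" using assms X_in_S that by auto
    then show ?thesis unfolding abs_mult by (intro mult_mono) auto
  qed
  have "\<bar>expectation (\<lambda>\<omega>. f (X r \<omega>) * g (X s \<omega>))\<bar> \<le> expectation (\<lambda>\<omega>. \<bar>f (X r \<omega>) * g (X s \<omega>)\<bar>)"
    by (rule integral_abs_bound)
  also have "\<dots> \<le> expectation (\<lambda>\<omega>. Bf * Bg)"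
    using b assms by (intro integral_mono integrable_abs integrable_const integrable_const_bound[of _ "Bf * Bg"] AE_I2 borel_measurable_times obs_measurable) (simp_all only: real_norm_def)
  finally show ?thesis by (simp add: prob_space)
qed

text \<open>If \<open>V = L g\<close>, the time integral of the correlation of \<open>f (X r)\<close> with \<open>V (X s)\<close> telescopes by
\<open>dynkin_two_time\<close> to a difference of two correlations. These are expectations, hence bounded by the suprema of \<open>f\<close> and
\<open>g\<close>, whatever the length of the interval.\<close>

lemma correlation_time_integral:
  fixes f g :: "'s \<Rightarrow> real"
  assumes "0 \<le> r" "r \<le> t"
    and "\<And>x. x \<in> S \<Longrightarrow> \<bar>f x\<bar> \<le> Bf" "\<And>x. x \<in> S \<Longrightarrow> \<bar>g x\<bar> \<le> Bg"
  shows "\<bar>LBINT s:{r..t}. expectation (\<lambda>\<omega>. f (X r \<omega>) * L g (X s \<omega>))\<bar> \<le> 2 * Bf * Bg"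
proof -
  let ?\<phi> = "\<lambda>g s. expectation (\<lambda>\<omega>. f (X r \<omega>) * g (X s \<omega>))"
  have d: "(?\<phi> g has_vector_derivative ?\<phi> (L g) s) (at s within {r..t})" if "r \<le> s" for s g
    using DERIV_subset[OF dynkin_two_time[OF assms(1) that, of f g], of "{r..t}"]
    by (auto simp: has_real_derivative_iff_has_vector_derivative)
  have "continuous_on {r..t} (?\<phi> (L g))"
    by (rule continuous_on_vector_derivative[OF d]) simp
  then have "(LBINT s:{r..t}. ?\<phi> (L g) s) = ?\<phi> g t - ?\<phi> g r"
    unfolding set_lebesgue_integral_def using assms(2) by (intro integral_FTC_atLeastAtMost d) auto
  also have "\<bar>\<dots>\<bar> \<le> Bf * Bg + Bf * Bg"
  proof -
    have "\<bar>?\<phi> g u\<bar> \<le> Bf * Bg" if "0 \<le> u" for u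
      using assms that by (intro expectation_le) auto
    from this[of r] this[of t] show ?thesis using assms(1,2) by linarith
  qed
  finally show ?thesis by simp
qed

text \<open>The square of the time integral is a double integral of the symmetric correlation
\<open>\<psi> r s = E[V(X\<^sub>r) V(X\<^sub>s)]\<close>. The part \<open>r < s\<close> is bounded by the previous lemma for every \<open>r\<close>, and
by symmetry the other part equals it. The bound grows only linearly in \<open>t\<close> and is small as soon as
the solution \<open>F\<close> of the Poisson equation is small.\<close>

lemma time_integral_second_moment:
  assumes t: "0 \<le> t" and F: "\<And>x. x \<in> S \<Longrightarrow> \<bar>F x\<bar> \<le> BF" and V: "\<And>x. x \<in> S \<Longrightarrow> \<bar>L F x\<bar> \<le> BV"
  shows "expectation (\<lambda>\<omega>. (LBINT s:{0..t}. L F (X s \<omega>))\<^sup>2) \<le> 4 * t * (BV * BF)"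
proof -
  interpret H: finite_measure "horizon t" by (rule finite_horizon)
  interpret HM: pair_sigma_finite "horizon t" M ..
  interpret HH: pair_sigma_finite "horizon t" "horizon t" ..
  interpret HMf: finite_measure "horizon t \<Otimes>\<^sub>M M"
    by (rule finite_measure_pair_measure) (unfold_locales)
  interpret HHf: finite_measure "horizon t \<Otimes>\<^sub>M horizon t"
    by (rule finite_measure_pair_measure) (unfold_locales)
  define Z where "Z s \<omega> = L F (X (max 0 s) \<omega>)" for s \<omega>
  define Y where "Y \<omega> = (\<integral>s. Z s \<omega> \<partial>horizon t)" for \<omega>
  define \<psi> where "\<psi> r s = expectation (\<lambda>\<omega>. Z r \<omega> * Z s \<omega>)" for r s
  have Y_eq: "(LBINT s:{0..t}. L F (X s \<omega>)) = Y \<omega>" for \<omega>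
    unfolding Y_def Z_def by (rule time_integral_max)
  have Zb: "\<bar>Z s \<omega>\<bar> \<le> BV" if "\<omega> \<in> space M" for s \<omega>
    unfolding Z_def using V X_in_S that by simp
  have Zm: "(\<lambda>p. Z (fst p) (snd p)) \<in> borel_measurable (horizon t \<Otimes>\<^sub>M M)"
    unfolding Z_def by (rule jointly_measurable_horizon)
  have BV: "BV \<ge> 0"
    using not_empty Zb[of _ 0] by (meson abs_ge_zero ex_in_conv order_trans)
  have Ym: "Y \<in> borel_measurable M"
    using time_integral_measurable[of t "L F"] unfolding Y_eq .
  have Yb: "\<bar>Y \<omega>\<bar> \<le> t * BV" if "\<omega> \<in> space M" for \<omega>
    using time_integral_le[of t \<omega> "L F" BV] t V that unfolding Y_eq by simp
  have ZZ: "\<bar>Z r \<omega> * Z s \<omega>\<bar> \<le> BV * BV" if "\<omega> \<in> space M" for r s \<omega>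
    unfolding abs_mult using Zb[OF that] by (intro mult_mono) (auto intro: order_trans[OF abs_ge_zero])
  have sec: "Z r \<in> borel_measurable M" for r
    unfolding Z_def by simp
  have "expectation (\<lambda>\<omega>. (Y \<omega>)\<^sup>2) = expectation (\<lambda>\<omega>. \<integral>r. Z r \<omega> * Y \<omega> \<partial>horizon t)"
    by (intro Bochner_Integration.integral_cong refl) (simp add: Y_def power2_eq_square)
  also have "\<dots> = (\<integral>r. expectation (\<lambda>\<omega>. Z r \<omega> * Y \<omega>) \<partial>horizon t)"
  proof (rule HM.Fubini_integral)
    show "integrable (horizon t \<Otimes>\<^sub>M M) (\<lambda>(r, \<omega>). Z r \<omega> * Y \<omega>)"
    proof (rule HMf.integrable_const_bound[where B = "BV * (t * BV)"])
      show "AE p in horizon t \<Otimes>\<^sub>M M. norm (case p of (r, \<omega>) \<Rightarrow> Z r \<omega> * Y \<omega>) \<le> BV * (t * BV)"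
        using Zb Yb BV by (intro AE_I2) (auto simp: abs_mult space_pair_measure intro!: mult_mono)
      show "(\<lambda>(r, \<omega>). Z r \<omega> * Y \<omega>) \<in> borel_measurable (horizon t \<Otimes>\<^sub>M M)"
        unfolding split_beta' using Zm Ym by measurable
    qed
  qed
  also have "\<dots> = (\<integral>r. \<integral>s. \<psi> r s \<partial>horizon t \<partial>horizon t)"
  proof (intro Bochner_Integration.integral_cong refl)
    fix r
    have "expectation (\<lambda>\<omega>. Z r \<omega> * Y \<omega>) = expectation (\<lambda>\<omega>. \<integral>s. Z r \<omega> * Z s \<omega> \<partial>horizon t)"
      by (simp add: Y_def)
    also have "\<dots> = (\<integral>s. \<psi> r s \<partial>horizon t)"
      unfolding \<psi>_def
    proof (rule HM.Fubini_integral)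
      show "integrable (horizon t \<Otimes>\<^sub>M M) (\<lambda>(s, \<omega>). Z r \<omega> * Z s \<omega>)"
      proof (rule HMf.integrable_const_bound[where B = "BV * BV"])
        show "AE p in horizon t \<Otimes>\<^sub>M M. norm (case p of (s, \<omega>) \<Rightarrow> Z r \<omega> * Z s \<omega>) \<le> BV * BV"
          using ZZ by (intro AE_I2) (auto simp: space_pair_measure)
        show "(\<lambda>(s, \<omega>). Z r \<omega> * Z s \<omega>) \<in> borel_measurable (horizon t \<Otimes>\<^sub>M M)"
          unfolding split_beta' using Zm measurable_compose[OF measurable_snd sec[of r]] by measurable
      qed
    qed
    finally show "expectation (\<lambda>\<omega>. Z r \<omega> * Y \<omega>) = (\<integral>s. \<psi> r s \<partial>horizon t)" .
  qed
  finally have second: "expectation (\<lambda>\<omega>. (Y \<omega>)\<^sup>2) = (\<integral>r. \<integral>s. \<psi> r s \<partial>horizon t \<partial>horizon t)" .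
  have \<psi>_sym: "\<psi> r s = \<psi> s r" for r s unfolding \<psi>_def by (simp add: mult.commute)
  have \<psi>b: "\<bar>\<psi> r s\<bar> \<le> BV * BV" for r s
    unfolding \<psi>_def Z_def using V by (intro expectation_le) auto
  have \<psi>m: "(\<lambda>p. \<psi> (fst p) (snd p)) \<in> borel_measurable (horizon t \<Otimes>\<^sub>M horizon t)"
    unfolding \<psi>_def
  proof (rule borel_measurable_lebesgue_integral)
    have "(\<lambda>q. (fst (fst q), snd q)) \<in> measurable ((horizon t \<Otimes>\<^sub>M horizon t) \<Otimes>\<^sub>M M) (horizon t \<Otimes>\<^sub>M M)"
      "(\<lambda>q. (snd (fst q), snd q)) \<in> measurable ((horizon t \<Otimes>\<^sub>M horizon t) \<Otimes>\<^sub>M M) (horizon t \<Otimes>\<^sub>M M)"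
      by measurable
    from measurable_compose[OF this(1) Zm] measurable_compose[OF this(2) Zm]
    show "(\<lambda>(p, \<omega>). Z (fst p) \<omega> * Z (snd p) \<omega>) \<in> borel_measurable ((horizon t \<Otimes>\<^sub>M horizon t) \<Otimes>\<^sub>M M)"
      by (simp add: split_beta')
  qed
  \<comment> \<open>The two triangles of the square; the diagonal belongs to the second one.\<close>
  define U where "U r s = indicator {r<..} s * \<psi> r s" for r s :: real
  define U' where "U' r s = indicator {..r} s * \<psi> r s" for r s :: real
  have idm: "(\<lambda>x. x) \<in> borel_measurable (horizon t)"
    by (rule measurable_restrict_space1) simp
  have Um: "(\<lambda>p. U (fst p) (snd p)) \<in> borel_measurable (horizon t \<Otimes>\<^sub>M horizon t)"
  proof -
    have "{p\<in>space (horizon t \<Otimes>\<^sub>M horizon t). fst p < snd p} \<in> sets (horizon t \<Otimes>\<^sub>M horizon t)"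
      using measurable_compose[OF measurable_fst idm] measurable_compose[OF measurable_snd idm] by measurable
    then have "(\<lambda>p. indicator {p\<in>space (horizon t \<Otimes>\<^sub>M horizon t). fst p < snd p} p * \<psi> (fst p) (snd p))
       \<in> borel_measurable (horizon t \<Otimes>\<^sub>M horizon t)"
      using \<psi>m by measurable
    then show ?thesis
      by (rule measurable_cong[THEN iffD1, rotated]) (auto simp: U_def indicator_def)
  qed
  have U'm: "(\<lambda>p. U' (fst p) (snd p)) \<in> borel_measurable (horizon t \<Otimes>\<^sub>M horizon t)"
  proof -
    have "(\<lambda>p. \<psi> (fst p) (snd p) - U (fst p) (snd p)) \<in> borel_measurable (horizon t \<Otimes>\<^sub>M horizon t)"
      using \<psi>m Um by measurable
    also have "(\<lambda>p. \<psi> (fst p) (snd p) - U (fst p) (snd p)) = (\<lambda>p. U' (fst p) (snd p))"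
      by (auto simp: U_def U'_def indicator_def)
    finally show ?thesis .
  qed
  have Ub: "\<bar>U r s\<bar> \<le> BV * BV" "\<bar>U' r s\<bar> \<le> BV * BV" for r s
    using \<psi>b[of r s] by (auto simp: U_def U'_def indicator_def)
  have Ui: "integrable (horizon t \<Otimes>\<^sub>M horizon t) (\<lambda>(r, s). U r s)"
    "integrable (horizon t \<Otimes>\<^sub>M horizon t) (\<lambda>(r, s). U' r s)"
    by (rule HHf.integrable_const_bound[of _ "BV * BV"]; use Ub Um U'm in \<open>auto simp: split_beta'\<close>)+
  have Us: "integrable (horizon t) (U r)" "integrable (horizon t) (U' r)"
     "integrable (horizon t) (\<lambda>s. U s r)" "integrable (horizon t) (\<lambda>s. U' s r)" if "r \<in> {0..t}" for r
  proof -
    have p: "(\<lambda>s. (r, s)) \<in> measurable (horizon t) (horizon t \<Otimes>\<^sub>M horizon t)"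
      "(\<lambda>s. (s, r)) \<in> measurable (horizon t) (horizon t \<Otimes>\<^sub>M horizon t)"
      using that by (auto intro!: measurable_Pair1' measurable_Pair2')
    show "integrable (horizon t) (U r)" "integrable (horizon t) (U' r)"
     "integrable (horizon t) (\<lambda>s. U s r)" "integrable (horizon t) (\<lambda>s. U' s r)"
      using measurable_compose[OF p(1) Um] measurable_compose[OF p(1) U'm]
        measurable_compose[OF p(2) Um] measurable_compose[OF p(2) U'm] Ub
      by (auto intro!: H.integrable_const_bound[of _ "BV * BV"])
  qed
  have half: "\<bar>\<integral>s. U r s \<partial>horizon t\<bar> \<le> 2 * (BV * BF)" if r: "r \<in> {0..t}" for r
  proof -
    have "(\<integral>s. U r s \<partial>horizon t) = (\<integral>s. indicator {0..t} s *\<^sub>R U r s \<partial>lborel)"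
      by (simp add: integral_restrict_space)
    also have "\<dots> = (LBINT s:{r..t}. expectation (\<lambda>\<omega>. L F (X r \<omega>) * L F (X s \<omega>)))"
      unfolding set_lebesgue_integral_def
    proof (rule integral_cong_AE)
      have m1: "(\<lambda>s. indicator {0..t} s *\<^sub>R U r s) \<in> borel_measurable lborel"
        using borel_measurable_restrict_space_iff[of "{0..t}" lborel "U r"] Us(1)[OF r] by auto
      show "(\<lambda>s. indicator {0..t} s *\<^sub>R U r s) \<in> borel_measurable lborel" by (rule m1)
      have "(\<lambda>s. indicator {r} s * \<psi> r r + indicator {0..t} s *\<^sub>R U r s) \<in> borel_measurable lborel"
        using m1 by measurable
      also have eq: "(\<lambda>s. indicator {r} s * \<psi> r r + indicator {0..t} s *\<^sub>R U r s)
        = (\<lambda>s. indicator {r..t} s *\<^sub>R expectation (\<lambda>\<omega>. L F (X r \<omega>) * L F (X s \<omega>)))"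
        using r by (auto simp: indicator_def U_def \<psi>_def Z_def)
      finally show "(\<lambda>s. indicator {r..t} s *\<^sub>R expectation (\<lambda>\<omega>. L F (X r \<omega>) * L F (X s \<omega>))) \<in> borel_measurable lborel" .
      show "AE s in lborel. indicator {0..t} s *\<^sub>R U r s
         = indicator {r..t} s *\<^sub>R expectation (\<lambda>\<omega>. L F (X r \<omega>) * L F (X s \<omega>))"
        unfolding fun_cong[OF eq, symmetric] using AE_lborel_singleton[of r] by eventually_elim auto
    qed
    also have "\<bar>\<dots>\<bar> \<le> 2 * BV * BF"
      using r V F by (intro correlation_time_integral) auto
    finally show ?thesis by simp
  qed
  have IU: "(\<integral>r. \<integral>s. U r s \<partial>horizon t \<partial>horizon t) \<le> t * (2 * (BV * BF))"
  proof -
    have "(\<integral>r. \<integral>s. U r s \<partial>horizon t \<partial>horizon t) \<le> (\<integral>r. 2 * (BV * BF) \<partial>horizon t)"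
      using half HH.integrable_fst'[OF Ui(1)]
      by (intro integral_mono) (auto simp: abs_le_iff)
    then show ?thesis using t by (simp add: measure_horizon)
  qed
  have "(\<integral>r. \<integral>s. \<psi> r s \<partial>horizon t \<partial>horizon t)
      = (\<integral>r. (\<integral>s. U r s \<partial>horizon t) + (\<integral>s. U' r s \<partial>horizon t) \<partial>horizon t)"
  proof (intro Bochner_Integration.integral_cong refl)
    fix r assume "r \<in> space (horizon t)"
    then have "(\<integral>s. U r s \<partial>horizon t) + (\<integral>s. U' r s \<partial>horizon t) = (\<integral>s. U r s + U' r s \<partial>horizon t)"
      using Us[of r] by simp
    also have "\<dots> = (\<integral>s. \<psi> r s \<partial>horizon t)"
      by (intro Bochner_Integration.integral_cong) (auto simp: U_def U'_def indicator_def)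
    finally show "(\<integral>s. \<psi> r s \<partial>horizon t) = (\<integral>s. U r s \<partial>horizon t) + (\<integral>s. U' r s \<partial>horizon t)" ..
  qed
  also have "\<dots> = (\<integral>r. \<integral>s. U r s \<partial>horizon t \<partial>horizon t) + (\<integral>r. \<integral>s. U' r s \<partial>horizon t \<partial>horizon t)"
    using HH.integrable_fst'[OF Ui(1)] HH.integrable_fst'[OF Ui(2)] by simp
  also have "(\<integral>r. \<integral>s. U' r s \<partial>horizon t \<partial>horizon t) = (\<integral>r. \<integral>s. U r s \<partial>horizon t \<partial>horizon t)"
  proof -
    have "(\<integral>r. \<integral>s. U' r s \<partial>horizon t \<partial>horizon t) = (\<integral>s. \<integral>r. U' r s \<partial>horizon t \<partial>horizon t)"
      by (rule HH.Fubini_integral[OF Ui(2), symmetric])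
    also have "\<dots> = (\<integral>s. \<integral>r. U s r \<partial>horizon t \<partial>horizon t)"
    proof (rule Bochner_Integration.integral_cong[OF refl])
      fix s assume s: "s \<in> space (horizon t)"
      have "AE r in horizon t. r \<noteq> s"
        unfolding AE_restrict_space_iff[of "{0..t}" lborel, simplified]
        using AE_lborel_singleton[of s] by eventually_elim auto
      then have "AE r in horizon t. U' r s = U s r"
        by eventually_elim (auto simp: U_def U'_def indicator_def \<psi>_sym[of s])
      then show "(\<integral>r. U' r s \<partial>horizon t) = (\<integral>r. U s r \<partial>horizon t)"
        using Us[of s] s by (intro integral_cong_AE) auto
    qed
    finally show ?thesis .
  qed
  finally show ?thesis unfolding Y_eq second using IU by (simp add: mult_ac)
qed

text \<open>An approximate solution of the Poisson equation suffices: its defect \<open>\<epsilon>\<close> is integrated in absolute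
value, and only the exact part \<open>L F\<close> profits from averaging.\<close>

lemma time_average_bound:
  assumes t: "0 \<le> t" and F: "\<And>x. x \<in> S \<Longrightarrow> \<bar>F x\<bar> \<le> BF" and V: "\<And>x. x \<in> S \<Longrightarrow> \<bar>L F x\<bar> \<le> BV"
    and W: "\<And>x. x \<in> S \<Longrightarrow> \<bar>L F x - W x\<bar> \<le> \<epsilon>"
  shows "expectation (\<lambda>\<omega>. \<bar>LBINT s:{0..t}. W (X s \<omega>)\<bar>) \<le> sqrt (4 * t * (BV * BF)) + t * \<epsilon>"
proof -
  define Y where "Y f \<omega> = (LBINT s:{0..t}. f (X s \<omega>))" for f :: "'s \<Rightarrow> real" and \<omega>
  have Yi: "integrable M (Y f)" for f
    unfolding Y_def using t by blast
  have Ysq: "integrable M (\<lambda>\<omega>. (Y f \<omega>)\<^sup>2)" for f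
  proof -
    obtain B where B: "\<forall>y\<in>S. \<bar>f y\<bar> \<le> B" using bounded_on_S by blast
    have "(Y f \<omega>)\<^sup>2 \<le> (t * B)\<^sup>2" if "\<omega> \<in> space M" for \<omega>
      using time_integral_le[OF t that, of f B] B unfolding Y_def
      by (intro power2_le_iff_abs_le[THEN iffD2]) (auto intro: order_trans[OF abs_ge_zero])
    then show ?thesis
      using Yi[of f] by (intro integrable_const_bound[of _ "(t * B)\<^sup>2"]) auto
  qed
  have "expectation (\<lambda>\<omega>. \<bar>Y (L F) \<omega>\<bar>) \<le> sqrt (4 * t * (BV * BF))"
    using time_integral_second_moment[OF t F V] time_integral_integrable[OF t, of "L F"] Ysq[of "L F"]
    by (intro abs_expectation_le_sqrt) (auto simp: Y_def)
  moreover have "\<bar>Y W \<omega>\<bar> \<le> \<bar>Y (L F) \<omega>\<bar> + t * \<epsilon>" if "\<omega> \<in> space M" for \<omega>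
  proof -
    have "Y (L F) \<omega> - Y W \<omega> = Y (\<lambda>x. L F x - W x) \<omega>"
      unfolding Y_def time_integral_max[of _ "L F"] time_integral_max[of _ W]
        time_integral_max[of _ "\<lambda>x. L F x - W x"]
      using that by (simp add: path_integrable)
    moreover have "\<bar>Y (\<lambda>x. L F x - W x) \<omega>\<bar> \<le> t * \<epsilon>"
      unfolding Y_def using time_integral_le[of t \<omega> "\<lambda>x. L F x - W x" \<epsilon>] t that W by simp
    ultimately show ?thesis by linarith
  qed
  then have "expectation (\<lambda>\<omega>. \<bar>Y W \<omega>\<bar>) \<le> expectation (\<lambda>\<omega>. \<bar>Y (L F) \<omega>\<bar> + t * \<epsilon>)"
    using Yi by (intro integral_mono) auto
  ultimately show ?thesis unfolding Y_def[symmetric] using Yi by (simp add: prob_space)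
qed

text \<open>Multiplied by the integrating factor \<open>exp (\<nu> * s)\<close>, the expectation has a derivative of size at
most \<open>\<epsilon> * exp (\<nu> * s)\<close>.\<close>

lemma relaxation:
  assumes nu: "0 \<le> \<nu>" and s: "0 \<le> s"
    and f: "\<And>x. x \<in> S \<Longrightarrow> \<bar>L f x + \<nu> * f x\<bar> \<le> \<epsilon>"
  shows "\<bar>expectation (\<lambda>\<omega>. f (X s \<omega>)) - exp (- \<nu> * s) * expectation (\<lambda>\<omega>. f (X 0 \<omega>))\<bar> \<le> s * \<epsilon>"
proof -
  let ?\<phi> = "\<lambda>g s. expectation (\<lambda>\<omega>. g (X s \<omega>))"
  have d: "((\<lambda>u. exp (\<nu> * u) * ?\<phi> f u) has_real_derivative exp (\<nu> * u) * (?\<phi> (L f) u + \<nu> * ?\<phi> f u))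
     (at u within {0..s})" if "u \<in> {0..s}" for u
  proof -
    have "(?\<phi> f has_real_derivative ?\<phi> (L f) u) (at u within {0..s})"
      using DERIV_subset[OF dynkin[of u f], of "{0..s}"] that by auto
    then show ?thesis by (auto intro!: derivative_eq_intros simp: algebra_simps)
  qed
  have b: "\<bar>exp (\<nu> * u) * (?\<phi> (L f) u + \<nu> * ?\<phi> f u)\<bar> \<le> exp (\<nu> * s) * \<epsilon>" if "u \<in> {0..s}" for u
  proof -
    have "?\<phi> (L f) u + \<nu> * ?\<phi> f u = ?\<phi> (\<lambda>x. L f x + \<nu> * f x) u"
      using that by simp
    also have "\<bar>\<dots>\<bar> \<le> 1 * \<epsilon>"
      using expectation_le[of u u "\<lambda>_. 1" 1 "\<lambda>x. L f x + \<nu> * f x" \<epsilon>] f that by simp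
    finally have "\<bar>?\<phi> (L f) u + \<nu> * ?\<phi> f u\<bar> \<le> \<epsilon>" by simp
    moreover have "exp (\<nu> * u) \<le> exp (\<nu> * s)" using that nu by (simp add: mult_left_mono)
    ultimately show ?thesis unfolding abs_mult by (intro mult_mono) auto
  qed
  have "norm (exp (\<nu> * s) * ?\<phi> f s - exp (\<nu> * 0) * ?\<phi> f 0) \<le> (exp (\<nu> * s) * \<epsilon>) * norm (s - 0)"
    by (rule field_differentiable_bound[of "{0..s}"]) (use d b s in auto)
  then have "\<bar>exp (\<nu> * s) * ?\<phi> f s - ?\<phi> f 0\<bar> \<le> exp (\<nu> * s) * (s * \<epsilon>)"
    using s by (simp add: mult_ac)
  then have "exp (- \<nu> * s) * \<bar>exp (\<nu> * s) * ?\<phi> f s - ?\<phi> f 0\<bar> \<le> exp (- \<nu> * s) * (exp (\<nu> * s) * (s * \<epsilon>))"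
    by (intro mult_left_mono) auto
  also have "\<dots> = s * \<epsilon>" by (simp add: exp_minus)
  also have "exp (- \<nu> * s) * \<bar>exp (\<nu> * s) * ?\<phi> f s - ?\<phi> f 0\<bar> = \<bar>exp (- \<nu> * s) * (exp (\<nu> * s) * ?\<phi> f s - ?\<phi> f 0)\<bar>"
    by (simp add: abs_mult)
  also have "exp (- \<nu> * s) * (exp (\<nu> * s) * ?\<phi> f s - ?\<phi> f 0) = ?\<phi> f s - exp (- \<nu> * s) * ?\<phi> f 0"
    by (simp add: exp_minus right_diff_distrib)
  finally show ?thesis .
qed

text \<open>If \<open>f\<close> and \<open>f\<^sup>2\<close> were eigenfunctions of \<open>L\<close> with eigenvalues \<open>- \<nu>\<close> and \<open>- 2 * \<nu>\<close>, the second moment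
of \<open>f (X s) - k * exp (- \<nu> * s)\<close> would be \<open>exp (- 2 * \<nu> * s)\<close> times the initial one. Approximate
eigenfunctions add an error linear in \<open>\<epsilon>\<close>. The hypothesis on \<open>f\<^sup>2\<close> holds when \<open>f\<close> relaxes and its
carre du champ is small.\<close>

lemma relaxation_second_moment:
  assumes nu: "0 \<le> \<nu>" and s: "0 \<le> s"
    and f: "\<And>x. x \<in> S \<Longrightarrow> \<bar>L f x + \<nu> * f x\<bar> \<le> \<epsilon>"
    and f2: "\<And>x. x \<in> S \<Longrightarrow> \<bar>L (\<lambda>x. (f x)\<^sup>2) x + 2 * \<nu> * (f x)\<^sup>2\<bar> \<le> \<epsilon>"
  shows "expectation (\<lambda>\<omega>. (f (X s \<omega>) - k * exp (- \<nu> * s))\<^sup>2)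
    \<le> expectation (\<lambda>\<omega>. (f (X 0 \<omega>) - k)\<^sup>2) + s * \<epsilon> * (1 + 2 * \<bar>k\<bar>)"
proof -
  let ?\<phi> = "\<lambda>g s. expectation (\<lambda>\<omega>. g (X s \<omega>))"
  define e where "e = exp (- \<nu> * s)"
  have e: "0 < e" "e \<le> 1" unfolding e_def using nu s by (auto simp: mult_nonneg_nonneg)
  have e2: "exp (- (2 * \<nu>) * s) = e\<^sup>2" unfolding e_def
    by (simp add: exp_double[symmetric] mult_ac)
  have expand: "expectation (\<lambda>\<omega>. (f (X u \<omega>) - a)\<^sup>2) = ?\<phi> (\<lambda>x. (f x)\<^sup>2) u - 2 * a * ?\<phi> f u + a\<^sup>2"
    if "0 \<le> u" for u a
    using that obs_integrable[OF that, of "\<lambda>x. (f x)\<^sup>2"] by (simp add: power2_diff prob_space mult_ac)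
  have 1: "\<bar>?\<phi> f s - e * ?\<phi> f 0\<bar> \<le> s * \<epsilon>"
    using relaxation[OF nu s f] unfolding e_def by simp
  have 2: "\<bar>?\<phi> (\<lambda>x. (f x)\<^sup>2) s - e\<^sup>2 * ?\<phi> (\<lambda>x. (f x)\<^sup>2) 0\<bar> \<le> s * \<epsilon>"
    using relaxation[of "2 * \<nu>", OF _ s f2] nu unfolding e2 by simp
  have "\<bar>k * e\<bar> \<le> \<bar>k\<bar>" using e by (simp add: abs_mult mult_left_le)
  then have 3: "\<bar>2 * (k * e) * (?\<phi> f s - e * ?\<phi> f 0)\<bar> \<le> 2 * \<bar>k\<bar> * (s * \<epsilon>)"
    unfolding abs_mult[of "2 * (k * e)"] using 1 by (intro mult_mono) auto
  have 4: "e\<^sup>2 * expectation (\<lambda>\<omega>. (f (X 0 \<omega>) - k)\<^sup>2) \<le> 1 * expectation (\<lambda>\<omega>. (f (X 0 \<omega>) - k)\<^sup>2)"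
    using e by (intro mult_right_mono) (auto simp: power_le_one)
  have "expectation (\<lambda>\<omega>. (f (X s \<omega>) - k * e)\<^sup>2) = e\<^sup>2 * expectation (\<lambda>\<omega>. (f (X 0 \<omega>) - k)\<^sup>2)
     + (?\<phi> (\<lambda>x. (f x)\<^sup>2) s - e\<^sup>2 * ?\<phi> (\<lambda>x. (f x)\<^sup>2) 0) - 2 * (k * e) * (?\<phi> f s - e * ?\<phi> f 0)"
    unfolding expand[OF s] expand[OF order_refl] by (simp add: algebra_simps power2_eq_square)
  also have "\<dots> \<le> expectation (\<lambda>\<omega>. (f (X 0 \<omega>) - k)\<^sup>2) + s * \<epsilon> + 2 * \<bar>k\<bar> * (s * \<epsilon>)"
    using 2 3 4 by linarith
  finally show ?thesis unfolding e_def by (simp add: algebra_simps)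
qed

lemma time_integral_abs_le:
  assumes t: "0 \<le> t"
    and h: "h \<in> borel_measurable borel" "\<And>s. s \<in> {0..t} \<Longrightarrow> \<bar>h s\<bar> \<le> Bh"
    and D: "\<And>s. s \<in> {0..t} \<Longrightarrow> expectation (\<lambda>\<omega>. \<bar>f (X s \<omega>) - h s\<bar>) \<le> D"
  shows "expectation (\<lambda>\<omega>. \<bar>LBINT s:{0..t}. f (X s \<omega>) - h s\<bar>) \<le> t * D"
proof -
  interpret H: finite_measure "horizon t" by (rule finite_horizon)
  interpret HM: pair_sigma_finite "horizon t" M ..
  interpret HMf: finite_measure "horizon t \<Otimes>\<^sub>M M"
    by (rule finite_measure_pair_measure) (unfold_locales)
  obtain B where B: "\<forall>y\<in>S. \<bar>f y\<bar> \<le> B" using bounded_on_S by blast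
  define Z where "Z s \<omega> = \<bar>f (X (max 0 s) \<omega>) - h s\<bar>" for s \<omega>
  have hm: "h \<in> borel_measurable (horizon t)"
    using h(1) by (intro measurable_restrict_space1) simp
  have Zm: "(\<lambda>p. Z (fst p) (snd p)) \<in> borel_measurable (horizon t \<Otimes>\<^sub>M M)"
    unfolding Z_def using jointly_measurable_horizon[of f t] measurable_compose[OF measurable_fst hm] by measurable
  have Zb: "\<bar>Z s \<omega>\<bar> \<le> B + Bh" if "\<omega> \<in> space M" "s \<in> {0..t}" for s \<omega>
  proof -
    have "\<bar>f (X (max 0 s) \<omega>)\<bar> \<le> B" using B X_in_S that by auto
    then show ?thesis unfolding Z_def using h(2)[OF that(2)] by linarith
  qed
  have Zi: "integrable (horizon t \<Otimes>\<^sub>M M) (\<lambda>(s, \<omega>). Z s \<omega>)"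
    by (rule HMf.integrable_const_bound[of _ "B + Bh"]) (use Zb Zm in \<open>auto simp: split_beta' space_pair_measure\<close>)
  have "expectation (\<lambda>\<omega>. \<bar>LBINT s:{0..t}. f (X s \<omega>) - h s\<bar>) \<le> expectation (\<lambda>\<omega>. \<integral>s. Z s \<omega> \<partial>horizon t)"
  proof (rule integral_mono_AE')
    show "integrable M (\<lambda>\<omega>. \<integral>s. Z s \<omega> \<partial>horizon t)"
      by (rule HM.integrable_snd[OF Zi])
    show "AE \<omega> in M. \<bar>LBINT s:{0..t}. f (X s \<omega>) - h s\<bar> \<le> (\<integral>s. Z s \<omega> \<partial>horizon t)"
    proof (rule AE_I2)
      fix \<omega>
      have "(LBINT s:{0..t}. f (X s \<omega>) - h s) = (\<integral>s. f (X (max 0 s) \<omega>) - h s \<partial>horizon t)"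
        unfolding set_integral_horizon by (intro Bochner_Integration.integral_cong) auto
      then show "\<bar>LBINT s:{0..t}. f (X s \<omega>) - h s\<bar> \<le> (\<integral>s. Z s \<omega> \<partial>horizon t)"
        unfolding Z_def by (simp add: integral_abs_bound)
    qed
  qed (auto simp: Z_def intro!: AE_I2 Bochner_Integration.integral_nonneg)
  also have "\<dots> = (\<integral>s. expectation (Z s) \<partial>horizon t)"
    using HM.Fubini_integral[OF Zi] by simp
  also have "\<dots> \<le> (\<integral>s. D \<partial>horizon t)"
    using HM.integrable_fst[OF Zi] D by (intro integral_mono) (auto simp: Z_def[abs_def])
  also have "\<dots> = t * D" using t by (simp add: measure_horizon)
  finally show ?thesis .
qed

end

section \<open>The exclusion generator on linear functions\<close>

definition linear_obs :: "nat \<Rightarrow> (nat \<Rightarrow> real) \<Rightarrow> config \<Rightarrow> real" where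
  "linear_obs N h \<eta> = (\<Sum>x\<in>sites N. h x * real (\<eta> x))"

lemma config_value: "\<eta> \<in> configs N \<Longrightarrow> x \<in> sites N \<Longrightarrow> \<eta> x = 0 \<or> \<eta> x = 1"
  unfolding configs_def by (auto dest: PiE_mem)

lemma config_bounds:
  assumes "\<eta> \<in> configs N" "x \<in> sites N"
  shows "0 \<le> real (\<eta> x)" "real (\<eta> x) \<le> 1"
  using config_value[OF assms] by auto

lemma finite_sites [simp]: "finite (sites N)"
  by (simp add: sites_def)

lemma card_sites: "card (sites N) = N - 1"
  by (simp add: sites_def)

lemma finite_configs: "finite (configs N)"
  unfolding configs_def by (intro finite_PiE) auto

lemma exchange_configs:
  assumes "\<eta> \<in> configs N" "x \<in> sites N" "y \<in> sites N"
  shows "exchange x y \<eta> \<in> configs N"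
  using assms unfolding configs_def exchange_def by (auto simp: PiE_iff extensional_def)

lemma flip_configs:
  assumes "\<eta> \<in> configs N" "x \<in> sites N"
  shows "flip x \<eta> \<in> configs N"
  using assms unfolding configs_def flip_def by (auto simp: PiE_iff extensional_def)

lemma bond_sites: "x \<in> {1..N - 2} \<Longrightarrow> x \<in> sites N \<and> x + 1 \<in> sites N"
  by (auto simp: sites_def)

lemma boundary_sites: "N \<ge> 2 \<Longrightarrow> 1 \<in> sites N \<and> N - 1 \<in> sites N"
  by (auto simp: sites_def)

lemma linear_obs_update:
  assumes "x \<in> sites N"
  shows "linear_obs N h (\<eta>(x := v)) = linear_obs N h \<eta> + h x * (real v - real (\<eta> x))"
proof -
  have "linear_obs N h (\<eta>(x := v)) = h x * real v + (\<Sum>z\<in>sites N - {x}. h z * real (\<eta> z))"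
    unfolding linear_obs_def using assms by (subst sum.remove[of _ x]) auto
  moreover have "linear_obs N h \<eta> = h x * real (\<eta> x) + (\<Sum>z\<in>sites N - {x}. h z * real (\<eta> z))"
    unfolding linear_obs_def using assms by (subst sum.remove[of _ x]) auto
  ultimately show ?thesis by (simp add: algebra_simps)
qed

lemma linear_obs_exchange:
  assumes "x \<in> sites N" "y \<in> sites N" "x \<noteq> y"
  shows "linear_obs N h (exchange x y \<eta>) - linear_obs N h \<eta> = (h y - h x) * (real (\<eta> x) - real (\<eta> y))"
  unfolding exchange_def using assms by (simp add: linear_obs_update algebra_simps)

lemma linear_obs_flip:
  assumes "\<eta> \<in> configs N" "x \<in> sites N"
  shows "linear_obs N h (flip x \<eta>) - linear_obs N h \<eta> = h x * (1 - 2 * real (\<eta> x))"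
  unfolding flip_def using assms config_value[OF assms] by (auto simp: linear_obs_update)

lemma boundary_rate_bounds:
  assumes "\<eta> \<in> configs N" "x \<in> sites N" "0 < a" "a < 1"
  shows "0 \<le> boundary_rate a x \<eta>" "boundary_rate a x \<eta> \<le> 1"
  using config_value[OF assms(1,2)] assms by (auto simp: boundary_rate_def)

lemma linear_obs_le:
  assumes "\<eta> \<in> configs N" "\<And>x. x \<in> sites N \<Longrightarrow> \<bar>h x\<bar> \<le> B" "0 \<le> B"
  shows "\<bar>linear_obs N h \<eta>\<bar> \<le> real N * B"
proof -
  have "\<bar>linear_obs N h \<eta>\<bar> \<le> (\<Sum>x\<in>sites N. B)"
    unfolding linear_obs_def
  proof (rule order_trans[OF sum_abs sum_mono])
    fix x assume x: "x \<in> sites N"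
    show "\<bar>h x * real (\<eta> x)\<bar> \<le> B"
      using config_value[OF assms(1) x] assms(2)[OF x] assms(3) by auto
  qed
  also have "\<dots> \<le> real N * B" using assms(3) by (simp add: card_sites mult_right_mono)
  finally show ?thesis .
qed

lemma gen_linear:
  "gen_accelerated c \<theta> \<alpha> \<beta> \<gamma> N (\<lambda>x. a * f x + b * g x)
    = (\<lambda>x. a * gen_accelerated c \<theta> \<alpha> \<beta> \<gamma> N f x + b * gen_accelerated c \<theta> \<alpha> \<beta> \<gamma> N g x)"
proof (rule ext)
  fix \<eta>
  have "gen_bulk N (\<lambda>x. a * f x + b * g x) \<eta> = a * gen_bulk N f \<eta> + b * gen_bulk N g \<eta>"
    unfolding gen_bulk_def by (simp add: sum_distrib_left sum.distrib[symmetric] algebra_simps)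
  then show "gen_accelerated c \<theta> \<alpha> \<beta> \<gamma> N (\<lambda>x. a * f x + b * g x) \<eta>
    = a * gen_accelerated c \<theta> \<alpha> \<beta> \<gamma> N f \<eta> + b * gen_accelerated c \<theta> \<alpha> \<beta> \<gamma> N g \<eta>"
    unfolding gen_accelerated_def gen_ssep_def gen_boundary_def by (simp add: algebra_simps)
qed

lemma gen_const: "gen_accelerated c \<theta> \<alpha> \<beta> \<gamma> N (\<lambda>_. a) \<eta> = 0"
  unfolding gen_accelerated_def gen_ssep_def gen_boundary_def gen_bulk_def by simp

lemma gen_affine:
  "gen_accelerated c \<theta> \<alpha> \<beta> \<gamma> N (\<lambda>x. f x - a) \<eta> = gen_accelerated c \<theta> \<alpha> \<beta> \<gamma> N f \<eta>"
  using fun_cong[OF gen_linear[of c \<theta> \<alpha> \<beta> \<gamma> N 1 f "-a" "\<lambda>_. 1"], of \<eta>] by (simp add: gen_const)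

lemma gen_bounded:
  assumes N: "N \<ge> 2" and c: "c > 0" and ab: "0 < \<alpha>" "\<alpha> < 1" "0 < \<beta>" "\<beta> < 1"
    and f: "\<And>\<xi>. \<xi> \<in> configs N \<Longrightarrow> \<bar>f \<xi>\<bar> \<le> B" and \<eta>: "\<eta> \<in> configs N"
  shows "\<bar>gen_accelerated c \<theta> \<alpha> \<beta> \<gamma> N f \<eta>\<bar>
    \<le> real N powr (2 + \<gamma>) * (2 * real (N - 2) + 4 * (c * real N powr (- \<theta>))) * B"
proof -
  let ?\<kappa> = "c * real N powr (- \<theta>)"
  have \<kappa>: "?\<kappa> \<ge> 0" using c by simp
  have d: "\<bar>f \<xi> - f \<eta>\<bar> \<le> 2 * B" if "\<xi> \<in> configs N" for \<xi>
    using f[OF that] f[OF \<eta>] by linarith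
  have "\<bar>gen_bulk N f \<eta>\<bar> \<le> (\<Sum>x = 1..N - 2. 2 * B)"
    unfolding gen_bulk_def
    using bond_sites \<eta> by (intro order_trans[OF sum_abs sum_mono] d exchange_configs) auto
  then have bulk: "\<bar>gen_bulk N f \<eta>\<bar> \<le> 2 * real (N - 2) * B" by simp
  have bd: "\<bar>gen_boundary c \<theta> N a x f \<eta>\<bar> \<le> ?\<kappa> * (2 * B)" if "0 < a" "a < 1" "x \<in> sites N" for a x
  proof -
    have "\<bar>gen_boundary c \<theta> N a x f \<eta>\<bar> = ?\<kappa> * (boundary_rate a x \<eta> * \<bar>f (flip x \<eta>) - f \<eta>\<bar>)"
      unfolding gen_boundary_def using boundary_rate_bounds[OF \<eta> that(3,1,2)] c by (simp add: abs_mult)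
    also have "\<dots> \<le> ?\<kappa> * (1 * (2 * B))"
      using boundary_rate_bounds[OF \<eta> that(3,1,2)] d[OF flip_configs[OF \<eta> that(3)]] \<kappa>
      by (intro mult_left_mono mult_mono) auto
    finally show ?thesis by simp
  qed
  have "\<bar>gen_ssep c \<theta> \<alpha> \<beta> N f \<eta>\<bar> \<le> 2 * real (N - 2) * B + ?\<kappa> * (2 * B) + ?\<kappa> * (2 * B)"
    unfolding gen_ssep_def
    using bulk bd[of \<alpha> 1] bd[of \<beta> "N - 1"] ab boundary_sites[OF N] by linarith
  then have "real N powr (2 + \<gamma>) * \<bar>gen_ssep c \<theta> \<alpha> \<beta> N f \<eta>\<bar>
     \<le> real N powr (2 + \<gamma>) * (2 * real (N - 2) * B + ?\<kappa> * (2 * B) + ?\<kappa> * (2 * B))"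
    by (intro mult_left_mono) auto
  then show ?thesis
    unfolding gen_accelerated_def by (simp add: abs_mult algebra_simps)
qed

lemma finite_generator_ssep:
  assumes "N \<ge> 2" "c > 0" "0 < \<alpha>" "\<alpha> < 1" "0 < \<beta>" "\<beta> < 1"
  shows "finite_generator (configs N) (gen_accelerated c \<theta> \<alpha> \<beta> \<gamma> N)
    (real N powr (2 + \<gamma>) * (2 * real (N - 2) + 4 * (c * real N powr (- \<theta>))))"
proof (rule finite_generator.intro)
  fix f :: "config \<Rightarrow> real" and B x
  assume "\<And>y. y \<in> configs N \<Longrightarrow> \<bar>f y\<bar> \<le> B" "x \<in> configs N"
  then show "\<bar>gen_accelerated c \<theta> \<alpha> \<beta> \<gamma> N f x\<bar>
      \<le> real N powr (2 + \<gamma>) * (2 * real (N - 2) + 4 * (c * real N powr (- \<theta>))) * B"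
    using assms by (intro gen_bounded)
qed (rule finite_configs, rule gen_linear)

lemma gen_ssep_linear_obs:
  assumes N: "N \<ge> 2" and \<eta>: "\<eta> \<in> configs N"
  shows "gen_ssep c \<theta> \<alpha> \<beta> N (linear_obs N h) \<eta>
    = (\<Sum>x = 1..N - 2. (h (x + 1) - h x) * (real (\<eta> x) - real (\<eta> (x + 1))))
      + c * real N powr (- \<theta>) * h 1 * (\<alpha> - real (\<eta> 1))
      + c * real N powr (- \<theta>) * h (N - 1) * (\<beta> - real (\<eta> (N - 1)))"
proof -
  have bd: "gen_boundary c \<theta> N a x (linear_obs N h) \<eta> = c * real N powr (- \<theta>) * h x * (a - real (\<eta> x))"
    if "x \<in> sites N" for a x
    unfolding gen_boundary_def linear_obs_flip[OF \<eta> that] boundary_rate_def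
    using config_value[OF \<eta> that] by (auto simp: algebra_simps)
  have "gen_bulk N (linear_obs N h) \<eta> = (\<Sum>x = 1..N - 2. (h (x + 1) - h x) * (real (\<eta> x) - real (\<eta> (x + 1))))"
    unfolding gen_bulk_def using bond_sites by (intro sum.cong refl linear_obs_exchange) auto
  then show ?thesis
    unfolding gen_ssep_def using bd boundary_sites[OF N] by simp
qed

text \<open>The remainder beyond the Leibniz term \<open>2 * f * L f\<close> is the carre du champ, the sum of rates times
squared jumps.\<close>

lemma gen_square:
  "gen_accelerated c \<theta> \<alpha> \<beta> \<gamma> N (\<lambda>\<xi>. (f \<xi>)\<^sup>2) \<eta> = 2 * f \<eta> * gen_accelerated c \<theta> \<alpha> \<beta> \<gamma> N f \<eta>
    + real N powr (2 + \<gamma>) * ((\<Sum>x = 1..N - 2. (f (exchange x (x + 1) \<eta>) - f \<eta>)\<^sup>2)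
      + c * real N powr (- \<theta>) * boundary_rate \<alpha> 1 \<eta> * (f (flip 1 \<eta>) - f \<eta>)\<^sup>2
      + c * real N powr (- \<theta>) * boundary_rate \<beta> (N - 1) \<eta> * (f (flip (N - 1) \<eta>) - f \<eta>)\<^sup>2)"
proof -
  have sq: "b\<^sup>2 - a\<^sup>2 = 2 * a * (b - a) + (b - a)\<^sup>2" for a b :: real
    by (simp add: power2_eq_square algebra_simps)
  have "gen_bulk N (\<lambda>\<xi>. (f \<xi>)\<^sup>2) \<eta> = 2 * f \<eta> * gen_bulk N f \<eta> + (\<Sum>x = 1..N - 2. (f (exchange x (x + 1) \<eta>) - f \<eta>)\<^sup>2)"
    unfolding gen_bulk_def sq by (simp add: sum_distrib_left sum.distrib)
  then show ?thesis
    unfolding gen_accelerated_def gen_ssep_def gen_boundary_def sq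
    by (simp add: algebra_simps)
qed

text \<open>The solution of the discrete Poisson equation with right-hand side \<open>g\<close> that has value \<open>b\<close> at
site \<open>1\<close> and incoming slope \<open>a\<close> to the left of it; choosing \<open>a\<close> and \<open>b\<close> amounts to choosing boundary conditions.\<close>

definition potential :: "real \<Rightarrow> real \<Rightarrow> (nat \<Rightarrow> real) \<Rightarrow> nat \<Rightarrow> real" where
  "potential b a g x = b + (real x - 1) * a + (\<Sum>z = 1..<x. \<Sum>y = 1..z. g y)"

lemma potential_1: "potential b a g 1 = b"
  by (simp add: potential_def)

lemma potential_step:
  assumes "x \<ge> 1"
  shows "potential b a g (x + 1) - potential b a g x = a + (\<Sum>y = 1..x. g y)"
  using assms by (simp add: potential_def algebra_simps)

lemma sum_of_partial_sums:
  fixes g :: "nat \<Rightarrow> real"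
  assumes "n \<ge> 1"
  shows "(\<Sum>z = 1..<n. \<Sum>y = 1..z. g y) = (\<Sum>y = 1..n. (real n - real y) * g y)"
  using assms
proof (induction n rule: dec_induct)
  case base
  then show ?case by simp
next
  case (step n)
  have "(\<Sum>y = 1..Suc n. (real (Suc n) - real y) * g y) = (\<Sum>y = 1..n. (real n - real y) * g y + g y)"
    by (simp add: algebra_simps)
  then show ?case using step by (simp add: sum.distrib)
qed

lemma abel_summation:
  fixes a :: real and g u :: "nat \<Rightarrow> real"
  assumes "n \<ge> 1"
  shows "(\<Sum>x = 1..n - 1. (a + (\<Sum>y = 1..x. g y)) * (u x - u (x + 1)))
    = (\<Sum>x = 1..n. g x * u x) - (\<Sum>x = 1..n. g x) * u n + a * (u 1 - u n)"
  using assms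
proof (induction n rule: dec_induct)
  case base
  then show ?case by simp
next
  case (step n)
  then obtain m where "n = Suc m" by (cases n) auto
  with step show ?case by (simp add: algebra_simps)
qed

text \<open>Summation by parts produces \<open>g\<close> in the bulk and leaves terms at the two end sites only. The
different uses below consist in choosing \<open>a\<close>, \<open>b\<close>, \<open>g\<close> so that these terms cancel or are small.\<close>

lemma gen_ssep_potential:
  assumes N: "N \<ge> 2" and \<eta>: "\<eta> \<in> configs N"
  shows "gen_ssep c \<theta> \<alpha> \<beta> N (linear_obs N (potential b a g)) \<eta>
    = linear_obs N g \<eta> - (\<Sum>x\<in>sites N. g x) * real (\<eta> (N - 1))
      + a * (real (\<eta> 1) - real (\<eta> (N - 1)))
      + c * real N powr (- \<theta>) * b * (\<alpha> - real (\<eta> 1))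
      + c * real N powr (- \<theta>) * potential b a g (N - 1) * (\<beta> - real (\<eta> (N - 1)))"
proof -
  have "(\<Sum>x = 1..N - 2. (potential b a g (x + 1) - potential b a g x) * (real (\<eta> x) - real (\<eta> (x + 1))))
    = (\<Sum>x = 1..N - 1 - 1. (a + (\<Sum>y = 1..x. g y)) * (real (\<eta> x) - real (\<eta> (x + 1))))"
    by (intro sum.cong) (auto simp: potential_step[simplified])
  also have "\<dots> = linear_obs N g \<eta> - (\<Sum>x\<in>sites N. g x) * real (\<eta> (N - 1)) + a * (real (\<eta> 1) - real (\<eta> (N - 1)))"
    unfolding linear_obs_def sites_def using N by (subst abel_summation) auto
  finally show ?thesis
    unfolding gen_ssep_linear_obs[OF N \<eta>] potential_1 by simp
qed

lemma partial_sum_le: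
  fixes g :: "nat \<Rightarrow> real"
  assumes "(\<Sum>x\<in>sites N. \<bar>g x\<bar>) \<le> A" "z < N"
  shows "\<bar>\<Sum>y = 1..z. g y\<bar> \<le> A"
proof -
  have "(\<Sum>y = 1..z. \<bar>g y\<bar>) \<le> (\<Sum>y\<in>sites N. \<bar>g y\<bar>)"
    by (rule sum_mono2) (use assms(2) in \<open>auto simp: sites_def\<close>)
  with sum_abs[of g "{1..z}"] assms(1) show ?thesis by linarith
qed

lemma sum_of_partial_sums_le:
  fixes g :: "nat \<Rightarrow> real"
  assumes "(\<Sum>x\<in>sites N. \<bar>g x\<bar>) \<le> A" "x \<in> sites N"
  shows "\<bar>\<Sum>z = 1..<x. \<Sum>y = 1..z. g y\<bar> \<le> real N * A"
proof -
  have A: "0 \<le> A" using assms(1) sum_nonneg[of "sites N" "\<lambda>x. \<bar>g x\<bar>"] by linarith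
  have "\<bar>\<Sum>z = 1..<x. \<Sum>y = 1..z. g y\<bar> \<le> (\<Sum>z = 1..<x. \<bar>\<Sum>y = 1..z. g y\<bar>)"
    by (rule sum_abs)
  also have "\<dots> \<le> (\<Sum>z = 1..<x. A)"
  proof (rule sum_mono)
    fix z assume "z \<in> {1..<x}"
    then have "z < N" using assms(2) by (auto simp: sites_def)
    then show "\<bar>\<Sum>y = 1..z. g y\<bar> \<le> A" by (rule partial_sum_le[OF assms(1)])
  qed
  also have "\<dots> = real (x - 1) * A" by simp
  also have "\<dots> \<le> real N * A"
    using assms(2) by (intro mult_right_mono A) (auto simp: sites_def)
  finally show ?thesis .
qed

lemma potential_le:
  assumes "(\<Sum>x\<in>sites N. \<bar>g x\<bar>) \<le> A" "x \<in> sites N"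
  shows "\<bar>potential b a g x - b\<bar> \<le> real N * (\<bar>a\<bar> + A)"
proof -
  have "\<bar>(real x - 1) * a\<bar> \<le> real N * \<bar>a\<bar>"
    unfolding abs_mult using assms(2) by (intro mult_right_mono) (auto simp: sites_def)
  then show ?thesis
    using sum_of_partial_sums_le[OF assms] unfolding potential_def distrib_left by linarith
qed

section \<open>Poisson equations with Robin and Neumann conditions\<close>

lemma linear_obs_l1:
  assumes "\<eta> \<in> configs N"
  shows "\<bar>linear_obs N g \<eta>\<bar> \<le> (\<Sum>x\<in>sites N. \<bar>g x\<bar>)"
  unfolding linear_obs_def
proof (rule order_trans[OF sum_abs sum_mono])
  fix x assume "x \<in> sites N"
  then show "\<bar>g x * real (\<eta> x)\<bar> \<le> \<bar>g x\<bar>" using config_value[OF assms, of x] by auto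
qed

lemma gen_scaled:
  "gen_accelerated c \<theta> \<alpha> \<beta> \<gamma> N (\<lambda>\<xi>. a * f \<xi>) \<eta> = a * (real N powr (2 + \<gamma>) * gen_ssep c \<theta> \<alpha> \<beta> N f \<eta>)"
  using fun_cong[OF gen_linear[of c \<theta> \<alpha> \<beta> \<gamma> N a f 0 f], of \<eta>] by (simp add: gen_accelerated_def)

text \<open>The mean occupation at site \<open>x\<close> in the stationary state: the affine function whose discrete gradient
balances the fluxes through both reservoirs.\<close>

definition stationary_profile :: "real \<Rightarrow> real \<Rightarrow> real \<Rightarrow> nat \<Rightarrow> nat \<Rightarrow> real" where
  "stationary_profile \<kappa> \<alpha> \<beta> N x =
     \<beta> - (\<beta> - \<alpha>) * ((1 + \<kappa> * (real N - 1 - real x)) / (2 + \<kappa> * (real N - 2)))"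

lemma stationary_profile_le:
  assumes "x \<in> sites N" "0 < \<kappa>" "0 < \<alpha>" "\<alpha> < 1" "0 < \<beta>" "\<beta> < 1"
  shows "\<bar>stationary_profile \<kappa> \<alpha> \<beta> N x\<bar> \<le> 2"
proof -
  define q where "q = (1 + \<kappa> * (real N - 1 - real x)) / (2 + \<kappa> * (real N - 2))"
  have x: "1 \<le> real x" "real x \<le> real N - 1" using assms(1) by (auto simp: sites_def)
  have n: "0 \<le> \<kappa> * (real N - 1 - real x)" "\<kappa> * (real N - 1 - real x) \<le> \<kappa> * (real N - 2)"
    using x assms(2) by (auto intro!: mult_nonneg_nonneg mult_left_mono)
  then have q: "0 \<le> q" "q \<le> 1" unfolding q_def by (auto simp: divide_le_eq_1)
  have "\<bar>(\<beta> - \<alpha>) * q\<bar> \<le> 1 * 1"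
    unfolding abs_mult using q assms by (intro mult_mono) auto
  then show ?thesis unfolding stationary_profile_def q_def[symmetric] using assms by linarith
qed

text \<open>The occupation of site \<open>1\<close> drops out of \<open>gen_ssep_potential\<close> if \<open>\<kappa> * b = a\<close>, and that of the last
site if \<open>\<kappa> * h (N - 1) = - a - G\<close> with \<open>G\<close> the total mass of \<open>g\<close>; the second condition determines
the slope \<open>a\<close>. The slope is bounded uniformly in \<open>N\<close> and \<open>\<kappa>\<close>, so the boundary value \<open>a / \<kappa>\<close>
contributes the term \<open>2 / \<kappa>\<close> of the bound and the bulk contributes the term of order \<open>N\<close>.\<close>

lemma robin_poisson_solution:
  fixes g :: "nat \<Rightarrow> real" and \<theta> :: real
  assumes N: "N \<ge> 4" and c: "c > 0" and A: "(\<Sum>x\<in>sites N. \<bar>g x\<bar>) \<le> A"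
  defines "\<kappa> \<equiv> c * real N powr (- \<theta>)"
  obtains h where
    "\<And>\<eta>. \<eta> \<in> configs N \<Longrightarrow> gen_ssep c \<theta> \<alpha> \<beta> N (linear_obs N h) \<eta>
        = linear_obs N g \<eta> - (\<Sum>x\<in>sites N. g x * stationary_profile \<kappa> \<alpha> \<beta> N x)"
    "\<And>x. x \<in> sites N \<Longrightarrow> \<bar>h x\<bar> \<le> A * (2 / \<kappa> + 3 * real N)"
proof -
  have \<kappa>: "\<kappa> > 0" using c N by (simp add: \<kappa>_def)
  define G where "G = (\<Sum>x\<in>sites N. g x)"
  define S where "S = (\<Sum>z = 1..<N - 1. \<Sum>y = 1..z. g y)"
  define d where "d = 2 + \<kappa> * (real N - 2)"
  define a where "a = - ((G + \<kappa> * S) / d)"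
  have d: "d > 0" unfolding d_def using \<kappa> N by (intro add_pos_nonneg mult_nonneg_nonneg) auto
  have A0: "0 \<le> A" using A sum_nonneg[of "sites N" "\<lambda>x. \<bar>g x\<bar>"] by linarith
  have ad: "a * d = - (G + \<kappa> * S)" using d by (simp add: a_def)
  have G: "\<bar>G\<bar> \<le> A" unfolding G_def using A sum_abs[of g "sites N"] by linarith
  have S: "\<bar>S\<bar> \<le> real N * A"
    unfolding S_def using N by (intro sum_of_partial_sums_le[OF A]) (auto simp: sites_def)
  have a: "\<bar>a\<bar> \<le> 2 * A"
  proof -
    have kS: "\<bar>\<kappa> * S\<bar> \<le> \<kappa> * (real N * A)" unfolding abs_mult using S \<kappa> by (intro mult_mono) auto
    have "\<bar>a\<bar> * d \<le> A + \<kappa> * (real N * A)"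
    proof -
      have "\<bar>a\<bar> * d = \<bar>G + \<kappa> * S\<bar>"
        using ad d by (metis abs_minus_cancel abs_mult abs_of_pos)
      then show ?thesis using kS G by linarith
    qed
    also have "\<dots> = A * (1 + \<kappa> * real N)" by (simp add: algebra_simps)
    also have "\<dots> \<le> A * (2 * d)"
    proof (rule mult_left_mono[OF _ A0])
      have "\<kappa> * 4 \<le> \<kappa> * real N" using \<kappa> N by (intro mult_left_mono) auto
      \<comment> \<open>By \<open>N \<ge> 4\<close>, the \<open>- 2\<close> in \<open>d\<close> costs at most half of \<open>N\<close>.\<close>
      then show "1 + \<kappa> * real N \<le> 2 * d" unfolding d_def by (simp add: algebra_simps)
    qed
    finally have "\<bar>a\<bar> * d \<le> (2 * A) * d" by (simp add: mult_ac)
    then show ?thesis using d by simp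
  qed
  define h where "h = potential (a / \<kappa>) a g"
  have hN: "\<kappa> * h (N - 1) = - a - G"
  proof -
    have "h (N - 1) = a / \<kappa> + (real N - 2) * a + S"
      unfolding h_def potential_def S_def using N by (simp add: of_nat_diff)
    then have "\<kappa> * h (N - 1) = a * d - a + \<kappa> * S" using \<kappa> by (simp add: d_def field_simps)
    then show ?thesis using ad by simp
  qed
  have stat: "(\<Sum>x\<in>sites N. g x * stationary_profile \<kappa> \<alpha> \<beta> N x) = (G + a) * \<beta> - a * \<alpha>"
  proof -
    have S': "S = (\<Sum>x\<in>sites N. (real N - 1 - real x) * g x)"
      unfolding S_def sites_def using N by (subst sum_of_partial_sums) (auto simp: of_nat_diff)
    have "(\<Sum>x\<in>sites N. g x * stationary_profile \<kappa> \<alpha> \<beta> N x)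
      = (\<Sum>x\<in>sites N. \<beta> * g x - (\<beta> - \<alpha>) / d * (g x + \<kappa> * ((real N - 1 - real x) * g x)))"
      unfolding stationary_profile_def d_def[symmetric] by (intro sum.cong refl) (simp add: algebra_simps add_divide_distrib diff_divide_distrib)
    also have "\<dots> = \<beta> * G - (\<beta> - \<alpha>) / d * (G + \<kappa> * S)"
      unfolding G_def S' by (simp only: sum_subtractf sum.distrib sum_distrib_left[symmetric])
    also have "\<dots> = \<beta> * G + (\<beta> - \<alpha>) * a" by (simp add: a_def)
    finally show ?thesis by (simp add: algebra_simps)
  qed
  show thesis
  proof (rule that)
    fix \<eta> assume \<eta>: "\<eta> \<in> configs N"
    have "gen_ssep c \<theta> \<alpha> \<beta> N (linear_obs N h) \<eta>
      = linear_obs N g \<eta> - G * real (\<eta> (N - 1)) + a * (real (\<eta> 1) - real (\<eta> (N - 1)))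
        + \<kappa> * (a / \<kappa>) * (\<alpha> - real (\<eta> 1)) + \<kappa> * h (N - 1) * (\<beta> - real (\<eta> (N - 1)))"
      unfolding h_def G_def \<kappa>_def using gen_ssep_potential[OF _ \<eta>] N by simp
    also have "\<dots> = linear_obs N g \<eta> - ((G + a) * \<beta> - a * \<alpha>)"
      unfolding hN using \<kappa> by (simp add: algebra_simps)
    finally show "gen_ssep c \<theta> \<alpha> \<beta> N (linear_obs N h) \<eta>
        = linear_obs N g \<eta> - (\<Sum>x\<in>sites N. g x * stationary_profile \<kappa> \<alpha> \<beta> N x)"
      unfolding stat .
  next
    fix x assume x: "x \<in> sites N"
    have "\<bar>h x - a / \<kappa>\<bar> \<le> real N * (\<bar>a\<bar> + A)"
      unfolding h_def by (rule potential_le[OF A x])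
    also have "\<dots> \<le> real N * (3 * A)" using a by (intro mult_left_mono) auto
    finally have 1: "\<bar>h x - a / \<kappa>\<bar> \<le> 3 * real N * A" by simp
    have "\<bar>a / \<kappa>\<bar> \<le> 2 * A / \<kappa>" using a \<kappa> by (simp add: abs_divide divide_right_mono)
    with 1 have "\<bar>h x\<bar> \<le> 2 * A / \<kappa> + 3 * real N * A" by linarith
    then show "\<bar>h x\<bar> \<le> A * (2 / \<kappa> + 3 * real N)" by (simp add: algebra_simps)
  qed
qed

text \<open>With \<open>a = b = 0\<close> and \<open>g\<close> of mean zero everything cancels except for the flux through the right
reservoir, which is of order \<open>\<kappa> * N\<close> and vanishes in the limit if \<open>\<theta> > 1\<close>.\<close>

lemma neumann_poisson_solution:
  fixes g :: "nat \<Rightarrow> real"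
  assumes N: "N \<ge> 2" and c: "c > 0" and ab: "0 < \<beta>" "\<beta> < 1"
    and A: "(\<Sum>x\<in>sites N. \<bar>g x\<bar>) \<le> A" and g: "(\<Sum>x\<in>sites N. g x) = 0"
  obtains h where
    "\<And>\<eta>. \<eta> \<in> configs N \<Longrightarrow> \<bar>gen_ssep c \<theta> \<alpha> \<beta> N (linear_obs N h) \<eta> - linear_obs N g \<eta>\<bar>
        \<le> c * real N powr (- \<theta>) * (real N * A)"
    "\<And>x. x \<in> sites N \<Longrightarrow> \<bar>h x\<bar> \<le> real N * A"
proof -
  have b: "\<bar>potential 0 0 g x\<bar> \<le> real N * A" if "x \<in> sites N" for x
    using potential_le[OF A that, of 0 0] by simp
  have "\<bar>gen_ssep c \<theta> \<alpha> \<beta> N (linear_obs N (potential 0 0 g)) \<eta> - linear_obs N g \<eta>\<bar>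
        \<le> c * real N powr (- \<theta>) * (real N * A)" if \<eta>: "\<eta> \<in> configs N" for \<eta>
  proof -
    have s: "N - 1 \<in> sites N" using boundary_sites[OF N] by simp
    have "\<bar>\<beta> - real (\<eta> (N - 1))\<bar> \<le> 1" using config_value[OF \<eta> s] ab by auto
    then have "\<bar>potential 0 0 g (N - 1) * (\<beta> - real (\<eta> (N - 1)))\<bar> \<le> real N * A * 1"
      unfolding abs_mult using b[OF s] by (intro mult_mono) auto
    then have "c * real N powr (- \<theta>) * \<bar>potential 0 0 g (N - 1) * (\<beta> - real (\<eta> (N - 1)))\<bar>
       \<le> c * real N powr (- \<theta>) * (real N * A)"
      using c by (intro mult_left_mono) auto
    moreover have "gen_ssep c \<theta> \<alpha> \<beta> N (linear_obs N (potential 0 0 g)) \<eta> - linear_obs N g \<eta>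
      = c * real N powr (- \<theta>) * (potential 0 0 g (N - 1) * (\<beta> - real (\<eta> (N - 1))))"
      unfolding gen_ssep_potential[OF N \<eta>] g by simp
    ultimately show ?thesis using c by (simp add: abs_mult)
  qed
  with b show thesis using that by blast
qed

lemma mean_density_linear_obs: "mean_density N \<eta> = linear_obs N (\<lambda>_. 1 / real (N - 1)) \<eta>"
  unfolding mean_density_def linear_obs_def by (simp add: sum_divide_distrib)

lemma mean_density_bounds:
  assumes "N \<ge> 2" "\<eta> \<in> configs N"
  shows "0 \<le> mean_density N \<eta>" "mean_density N \<eta> \<le> 1"
proof -
  show "0 \<le> mean_density N \<eta>" unfolding mean_density_def by (simp add: sum_nonneg)
  have "(\<Sum>x\<in>sites N. real (\<eta> x)) \<le> (\<Sum>x\<in>sites N. 1)"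
    using config_bounds[OF assms(2)] by (intro sum_mono) auto
  then show "mean_density N \<eta> \<le> 1"
    unfolding mean_density_def using assms(1) by (simp add: card_sites divide_le_eq_1)
qed

section \<open>The corrected mass\<close>

text \<open>The weight \<open>1 / (N - 1)\<close> of the mean density plus \<open>\<kappa> / (N - 1)\<close> times the parabola
\<open>(x - 1) * (N - 1 - x) / (N - 1)\<close>, written as a potential in order to apply
\<open>gen_ssep_potential\<close>.\<close>

definition corrected_weight :: "real \<Rightarrow> nat \<Rightarrow> nat \<Rightarrow> real" where
  "corrected_weight \<kappa> N =
     potential (1 / (real N - 1)) (\<kappa> / (real N - 1)) (\<lambda>_. - 2 * \<kappa> / (real N - 1)\<^sup>2)"

text \<open>The mean density loses and gains mass through the end sites, at rate \<open>\<kappa> / (N - 1)\<close> times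
\<open>\<alpha> + \<beta> - \<eta> 1 - \<eta> (N - 1)\<close>. The parabola vanishes at both end sites, so it creates no further
boundary terms, and its discrete Laplacian turns the two boundary occupations into twice the mean
density. Hence the drift of the corrected mass is a function of the mean density only.\<close>

lemma corrected_mass:
  fixes N :: nat and c \<theta> \<alpha> \<beta> :: real
  assumes N: "N \<ge> 2" and c: "c > 0" and \<eta>: "\<eta> \<in> configs N"
  defines "\<kappa> \<equiv> c * real N powr (- \<theta>)"
  shows "gen_ssep c \<theta> \<alpha> \<beta> N (linear_obs N (corrected_weight \<kappa> N)) \<eta>
      = \<kappa> / (real N - 1) * (\<alpha> + \<beta> - 2 * mean_density N \<eta>)"
    and "\<bar>linear_obs N (corrected_weight \<kappa> N) \<eta> - mean_density N \<eta>\<bar> \<le> 3 * \<kappa> * real N"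
    and "corrected_weight \<kappa> N 1 = 1 / (real N - 1)"
    and "corrected_weight \<kappa> N (N - 1) = 1 / (real N - 1)"
    and "\<And>x. x \<in> {1..N - 2} \<Longrightarrow> \<bar>corrected_weight \<kappa> N (x + 1) - corrected_weight \<kappa> N x\<bar> \<le> 3 * \<kappa> / (real N - 1)"
proof -
  define m where "m = real N - 1"
  have m: "m > 0" "real (N - 1) = m" using N by (auto simp: m_def of_nat_diff)
  have \<kappa>: "\<kappa> > 0" using c N by (simp add: \<kappa>_def)
  let ?q = "corrected_weight \<kappa> N"
  let ?g = "\<lambda>_::nat. - 2 * \<kappa> / m\<^sup>2"
  have q: "?q = potential (1 / m) (\<kappa> / m) ?g" unfolding corrected_weight_def m_def ..
  have gsum: "(\<Sum>x\<in>sites N. ?g x) = - 2 * \<kappa> / m"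
    using m by (simp add: card_sites power2_eq_square)
  have gabs: "(\<Sum>x\<in>sites N. \<bar>?g x\<bar>) \<le> 2 * \<kappa> / m"
    using m \<kappa> by (simp add: card_sites power2_eq_square abs_mult)
  show q1: "?q 1 = 1 / (real N - 1)" unfolding q m_def by (rule potential_1)
  \<comment> \<open>The second difference of the parabola is constant, so its value at the last site is a triangular sum.\<close>
  have tri: "(\<Sum>z = 1..<n. real z) = real n * (real n - 1) / 2" if "n \<ge> 1" for n
    using that by (induction n rule: dec_induct) (auto simp: field_simps)
  have "(\<Sum>z = 1..<N - 1. \<Sum>y = 1..z. ?g y) = (\<Sum>z = 1..<N - 1. real z) * (- 2 * \<kappa> / m\<^sup>2)"
    unfolding sum_distrib_right by (intro sum.cong) auto
  also have "\<dots> = - (m - 1) * \<kappa> / m"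
    using m N by (subst tri) (auto simp: power2_eq_square field_simps)
  finally have ds: "(\<Sum>z = 1..<N - 1. \<Sum>y = 1..z. ?g y) = - (m - 1) * \<kappa> / m" .
  show qN: "?q (N - 1) = 1 / (real N - 1)"
    unfolding q potential_def ds unfolding m(2) m_def[symmetric] using m(1) by (simp add: field_simps)
  have "linear_obs N ?g \<eta> = - 2 * \<kappa> / m * mean_density N \<eta>"
    unfolding linear_obs_def mean_density_def m(2) sum_distrib_left[symmetric]
    by (simp add: power2_eq_square)
  then show "gen_ssep c \<theta> \<alpha> \<beta> N (linear_obs N ?q) \<eta> = \<kappa> / (real N - 1) * (\<alpha> + \<beta> - 2 * mean_density N \<eta>)"
    unfolding q gen_ssep_potential[OF N \<eta>] gsum \<kappa>_def[symmetric] qN[unfolded q] m_def[symmetric]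
    by (simp add: algebra_simps diff_divide_distrib add_divide_distrib)
  show "\<bar>linear_obs N ?q \<eta> - mean_density N \<eta>\<bar> \<le> 3 * \<kappa> * real N"
  proof -
    have "linear_obs N ?q \<eta> - mean_density N \<eta> = linear_obs N (\<lambda>x. ?q x - 1 / m) \<eta>"
      unfolding mean_density_linear_obs m(2) linear_obs_def by (simp add: sum_subtractf left_diff_distrib)
    also have "\<bar>\<dots>\<bar> \<le> (\<Sum>x\<in>sites N. \<bar>?q x - 1 / m\<bar>)"
      by (rule linear_obs_l1[OF \<eta>])
    also have "\<dots> \<le> (\<Sum>x\<in>sites N. real N * (3 * \<kappa> / m))"
    proof (rule sum_mono)
      fix x assume x: "x \<in> sites N"
      have "\<bar>?q x - 1 / m\<bar> \<le> real N * (\<bar>\<kappa> / m\<bar> + 2 * \<kappa> / m)"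
        unfolding q by (rule potential_le[OF gabs x])
      also have "\<bar>\<kappa> / m\<bar> + 2 * \<kappa> / m = 3 * \<kappa> / m" using m \<kappa> by (simp add: add_divide_distrib[symmetric])
      finally show "\<bar>?q x - 1 / m\<bar> \<le> real N * (3 * \<kappa> / m)" .
    qed
    also have "\<dots> = 3 * \<kappa> * real N" using m by (simp add: card_sites)
    finally show ?thesis .
  qed
  show "\<bar>?q (x + 1) - ?q x\<bar> \<le> 3 * \<kappa> / (real N - 1)" if "x \<in> {1..N - 2}" for x
  proof -
    have x: "x \<ge> 1" "x < N" using that by auto
    have "?q (x + 1) - ?q x = \<kappa> / m + (\<Sum>y = 1..x. ?g y)"
      unfolding q by (rule potential_step[OF x(1)])
    also have "\<bar>\<dots>\<bar> \<le> \<bar>\<kappa> / m\<bar> + 2 * \<kappa> / m"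
      using partial_sum_le[OF gabs x(2)] by linarith
    also have "\<dots> = 3 * \<kappa> / m" using m \<kappa> by (simp add: add_divide_distrib[symmetric])
    finally show ?thesis unfolding m_def .
  qed
qed

text \<open>The first error in \<open>\<epsilon>\<close> compares \<open>\<nu>\<close> with the exact relaxation rate of the mean density, the second
one the corrected mass with the mean density. In the estimate for \<open>f\<^sup>2\<close> the last summand
bounds the carre du champ: bulk jumps have size at most \<open>3 * \<kappa> / (N - 1)\<close>, and boundary jumps,
which occur at rate at most \<open>\<kappa>\<close>, have size \<open>1 / (N - 1)\<close>.\<close>

lemma corrected_mass_relaxation:
  fixes N :: nat and c \<theta> \<alpha> \<beta> \<gamma> \<nu> :: real
  assumes N: "N \<ge> 2" and c: "c > 0" and ab: "0 < \<alpha>" "\<alpha> < 1" "0 < \<beta>" "\<beta> < 1"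
    and \<eta>: "\<eta> \<in> configs N" and \<nu>: "0 \<le> \<nu>"
  defines "\<kappa> \<equiv> c * real N powr (- \<theta>)"
  defines "K \<equiv> real N powr (2 + \<gamma>)"
  defines "\<delta> \<equiv> 3 * \<kappa> * real N"
  defines "f \<equiv> (\<lambda>\<xi>. linear_obs N (corrected_weight \<kappa> N) \<xi> - (\<alpha> + \<beta>) / 2)"
  defines "\<epsilon> \<equiv> \<bar>\<nu> - 2 * K * \<kappa> / (real N - 1)\<bar> + \<nu> * \<delta>"
  shows "\<bar>gen_accelerated c \<theta> \<alpha> \<beta> \<gamma> N f \<eta> + \<nu> * f \<eta>\<bar> \<le> \<epsilon>"
    and "\<bar>gen_accelerated c \<theta> \<alpha> \<beta> \<gamma> N (\<lambda>\<xi>. (f \<xi>)\<^sup>2) \<eta> + 2 * \<nu> * (f \<eta>)\<^sup>2\<bar>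
      \<le> 2 * (1 + \<delta>) * \<epsilon> + K * (9 * \<kappa>\<^sup>2 * real N + 2 * \<kappa>) / (real N - 1)\<^sup>2"
proof -
  let ?L = "gen_accelerated c \<theta> \<alpha> \<beta> \<gamma> N" and ?q = "corrected_weight \<kappa> N"
  have \<kappa>: "\<kappa> > 0" and K: "K > 0" using c N by (auto simp: \<kappa>_def K_def)
  have m: "real N - 1 > 0" using N by auto
  note cm = corrected_mass[OF N c \<eta>, where \<theta> = \<theta>, folded \<kappa>_def]
  define u where "u = mean_density N \<eta> - (\<alpha> + \<beta>) / 2"
  have u: "\<bar>u\<bar> \<le> 1" using mean_density_bounds[OF N \<eta>] ab unfolding u_def abs_le_iff by (simp add: field_simps)
  have fu: "\<bar>f \<eta> - u\<bar> \<le> \<delta>" using cm(2) by (simp add: f_def u_def \<delta>_def)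
  have \<delta>: "\<delta> \<ge> 0" using fu by linarith
  have "?L f \<eta> = K * (\<kappa> / (real N - 1) * (\<alpha> + \<beta> - 2 * mean_density N \<eta>))"
    unfolding f_def gen_affine using cm(1)[of \<alpha> \<beta>] by (simp add: gen_accelerated_def K_def)
  also have "\<dots> = - (2 * K * \<kappa> / (real N - 1)) * u"
  proof -
    have "\<alpha> + \<beta> - 2 * mean_density N \<eta> = - 2 * u" by (simp add: u_def field_simps)
    then show ?thesis by simp
  qed
  finally have eq: "?L f \<eta> + \<nu> * f \<eta> = (\<nu> - 2 * K * \<kappa> / (real N - 1)) * u + \<nu> * (f \<eta> - u)"
    by (simp add: algebra_simps)
  have b1: "\<bar>(\<nu> - 2 * K * \<kappa> / (real N - 1)) * u\<bar> \<le> \<bar>\<nu> - 2 * K * \<kappa> / (real N - 1)\<bar> * 1"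
    unfolding abs_mult using u by (intro mult_left_mono) auto
  have b2: "\<bar>\<nu> * (f \<eta> - u)\<bar> \<le> \<nu> * \<delta>"
    unfolding abs_mult using fu \<nu> by (simp add: mult_left_mono)
  show 1: "\<bar>?L f \<eta> + \<nu> * f \<eta>\<bar> \<le> \<epsilon>" 
    unfolding eq \<epsilon>_def using b1 b2 by (intro order_trans[OF abs_triangle_ineq] add_mono) simp_all
  \<comment> \<open>The carre du champ of \<open>f\<close>.\<close>
  define \<Gamma> where "\<Gamma> = K * ((\<Sum>x = 1..N - 2. (f (exchange x (x + 1) \<eta>) - f \<eta>)\<^sup>2)
      + \<kappa> * boundary_rate \<alpha> 1 \<eta> * (f (flip 1 \<eta>) - f \<eta>)\<^sup>2
      + \<kappa> * boundary_rate \<beta> (N - 1) \<eta> * (f (flip (N - 1) \<eta>) - f \<eta>)\<^sup>2)"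
  have jump: "(y * v)\<^sup>2 \<le> B\<^sup>2" if "\<bar>y\<bar> \<le> B" "\<bar>v\<bar> \<le> 1" for y v B :: real
  proof -
    have "\<bar>y * v\<bar> \<le> B * 1" unfolding abs_mult using that by (intro mult_mono) auto
    then show ?thesis by (intro power2_le_iff_abs_le[THEN iffD2]) auto
  qed
  have bulk: "(\<Sum>x = 1..N - 2. (f (exchange x (x + 1) \<eta>) - f \<eta>)\<^sup>2) \<le> real N * (3 * \<kappa> / (real N - 1))\<^sup>2"
  proof -
    have "(\<Sum>x = 1..N - 2. (f (exchange x (x + 1) \<eta>) - f \<eta>)\<^sup>2) \<le> (\<Sum>x = 1..N - 2. (3 * \<kappa> / (real N - 1))\<^sup>2)"
    proof (rule sum_mono)
      fix x assume x: "x \<in> {1..N - 2}"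
      have s: "x \<in> sites N" "x + 1 \<in> sites N" using bond_sites[OF x] by auto
      have "f (exchange x (x + 1) \<eta>) - f \<eta> = (?q (x + 1) - ?q x) * (real (\<eta> x) - real (\<eta> (x + 1)))"
        using linear_obs_exchange[OF s, of ?q \<eta>] by (simp add: f_def)
      moreover have "\<bar>real (\<eta> x) - real (\<eta> (x + 1))\<bar> \<le> 1"
        using config_bounds[OF \<eta> s(1)] config_bounds[OF \<eta> s(2)] by linarith
      ultimately show "(f (exchange x (x + 1) \<eta>) - f \<eta>)\<^sup>2 \<le> (3 * \<kappa> / (real N - 1))\<^sup>2"
        using jump[OF cm(5)[OF x]] by simp
    qed
    also have "\<dots> = real (N - 2) * (3 * \<kappa> / (real N - 1))\<^sup>2" by simp
    also have "\<dots> \<le> real N * (3 * \<kappa> / (real N - 1))\<^sup>2" by (intro mult_right_mono) auto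
    finally show ?thesis .
  qed
  have bd: "0 \<le> \<kappa> * boundary_rate a x \<eta> * (f (flip x \<eta>) - f \<eta>)\<^sup>2"
     "\<kappa> * boundary_rate a x \<eta> * (f (flip x \<eta>) - f \<eta>)\<^sup>2 \<le> \<kappa> * (1 / (real N - 1))\<^sup>2"
    if "x \<in> sites N" "0 < a" "a < 1" "?q x = 1 / (real N - 1)" for a x
  proof -
    have "f (flip x \<eta>) - f \<eta> = 1 / (real N - 1) * (1 - 2 * real (\<eta> x))"
      using linear_obs_flip[OF \<eta> that(1), of ?q] that(4) by (simp add: f_def)
    moreover have "\<bar>1 - 2 * real (\<eta> x)\<bar> \<le> 1" using config_bounds[OF \<eta> that(1)] by linarith
    ultimately have sq: "(f (flip x \<eta>) - f \<eta>)\<^sup>2 \<le> (1 / (real N - 1))\<^sup>2"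
      using jump[of "1 / (real N - 1)" "1 / (real N - 1)"] m by simp
    note br = boundary_rate_bounds[OF \<eta> that(1,2,3)]
    show "0 \<le> \<kappa> * boundary_rate a x \<eta> * (f (flip x \<eta>) - f \<eta>)\<^sup>2"
      using br \<kappa> by simp
    have "\<kappa> * boundary_rate a x \<eta> * (f (flip x \<eta>) - f \<eta>)\<^sup>2 \<le> \<kappa> * 1 * (1 / (real N - 1))\<^sup>2"
      using br \<kappa> sq by (intro mult_mono mult_left_mono) auto
    then show "\<kappa> * boundary_rate a x \<eta> * (f (flip x \<eta>) - f \<eta>)\<^sup>2 \<le> \<kappa> * (1 / (real N - 1))\<^sup>2" by simp
  qed
  note s = boundary_sites[OF N]
  have \<Gamma>: "0 \<le> \<Gamma>" "\<Gamma> \<le> K * (9 * \<kappa>\<^sup>2 * real N + 2 * \<kappa>) / (real N - 1)\<^sup>2"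
  proof -
    show "0 \<le> \<Gamma>"
      unfolding \<Gamma>_def using s ab cm(3,4)
      by (intro mult_nonneg_nonneg[OF less_imp_le[OF K]] add_nonneg_nonneg sum_nonneg
          zero_le_power2 bd(1)) auto
    have "\<Gamma> \<le> K * (real N * (3 * \<kappa> / (real N - 1))\<^sup>2 + \<kappa> * (1 / (real N - 1))\<^sup>2 + \<kappa> * (1 / (real N - 1))\<^sup>2)"
      unfolding \<Gamma>_def using bulk bd(2)[of 1 \<alpha>] bd(2)[of "N - 1" \<beta>] s ab cm(3,4) K
      by (intro mult_left_mono add_mono) auto
    also have "\<dots> = K * (9 * \<kappa>\<^sup>2 * real N + 2 * \<kappa>) / (real N - 1)\<^sup>2"
      by (simp add: power_divide power_mult_distrib add_divide_distrib algebra_simps)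
    finally show "\<Gamma> \<le> K * (9 * \<kappa>\<^sup>2 * real N + 2 * \<kappa>) / (real N - 1)\<^sup>2" .
  qed
  have "?L (\<lambda>\<xi>. (f \<xi>)\<^sup>2) \<eta> = 2 * f \<eta> * ?L f \<eta> + \<Gamma>"
    unfolding gen_square[of c \<theta> \<alpha> \<beta> \<gamma> N f \<eta>] \<Gamma>_def K_def \<kappa>_def by simp
  then have "?L (\<lambda>\<xi>. (f \<xi>)\<^sup>2) \<eta> + 2 * \<nu> * (f \<eta>)\<^sup>2 = 2 * f \<eta> * (?L f \<eta> + \<nu> * f \<eta>) + \<Gamma>"
    by (simp add: algebra_simps power2_eq_square)
  moreover have "\<bar>2 * f \<eta> * (?L f \<eta> + \<nu> * f \<eta>)\<bar> \<le> 2 * (1 + \<delta>) * \<epsilon>"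
    unfolding abs_mult[of "2 * f \<eta>"] using 1 fu u \<delta> by (intro mult_mono) auto
  ultimately show "\<bar>?L (\<lambda>\<xi>. (f \<xi>)\<^sup>2) \<eta> + 2 * \<nu> * (f \<eta>)\<^sup>2\<bar>
      \<le> 2 * (1 + \<delta>) * \<epsilon> + K * (9 * \<kappa>\<^sup>2 * real N + 2 * \<kappa>) / (real N - 1)\<^sup>2"
    using \<Gamma> by linarith
qed

section \<open>Limits of sums over the sites\<close>

text \<open>Uniform continuity bounds the error on each cell. The sites omit the right endpoint \<open>1\<close> of the grid,
which costs \<open>G 1 / N\<close>.\<close>

lemma riemann_sum_sites:
  fixes G :: "real \<Rightarrow> real"
  assumes "continuous_on {0..1} G"
  shows "(\<lambda>N. \<Sum>x\<in>sites N. G (real x / real N) / real N) \<longlonglongrightarrow> (LBINT u:{0..1}. G u)"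
proof -
  let ?I = "\<lambda>a b. integral {a..b} G"
  have I: "(LBINT u:{0..1}. G u) = ?I 0 1"
    using borel_integrable_atLeastAtMost'[OF assms] by (rule set_borel_integral_eq_integral)
  have cont: "continuous_on {a..b} G" if "0 \<le> a" "b \<le> 1" for a b
    using assms that by (auto intro: continuous_on_subset)
  have full: "(\<lambda>N. \<Sum>x = 1..N. G (real x / real N) / real N) \<longlonglongrightarrow> ?I 0 1"
  proof (rule LIMSEQ_I)
    fix r :: real assume r: "r > 0"
    have "uniformly_continuous_on {0..1} G"
      using assms by (intro compact_uniformly_continuous) auto
    then obtain d where d: "d > 0" "\<And>x y. x \<in> {0..1} \<Longrightarrow> y \<in> {0..1} \<Longrightarrow> dist y x < d \<Longrightarrow> dist (G y) (G x) < r / 2"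
      unfolding uniformly_continuous_on_def using r by (metis half_gt_zero)
    obtain n0 :: nat where n0: "1 / d < real n0" using reals_Archimedean2 by blast
    show "\<exists>no. \<forall>n\<ge>no. norm ((\<Sum>x = 1..n. G (real x / real n) / real n) - ?I 0 1) < r"
    proof (intro exI allI impI)
      fix N assume N: "N \<ge> Suc n0"
      have Np: "real N > 0" and Nd: "1 / real N < d"
      proof -
        show "real N > 0" using N by simp
        have "1 / d < real N" using n0 N by linarith
        then show "1 / real N < d" using d(1) \<open>real N > 0\<close> by (simp add: field_simps)
      qed
      have step: "\<bar>(\<Sum>x = 1..k. G (real x / real N) / real N) - ?I 0 (real k / real N)\<bar> \<le> real k * (r / 2 / real N)"
        if "k \<le> N" for k
        using that
      proof (induction k)
        case 0
        then show ?case by simp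
      next
        case (Suc k)
        let ?a = "real k / real N" and ?b = "real (Suc k) / real N"
        have ab: "0 \<le> ?a" "?a \<le> ?b" "?b \<le> 1" "?b - ?a = 1 / real N"
          using Suc.prems Np by (auto simp: field_simps)
        have comb: "?I 0 ?b = ?I 0 ?a + ?I ?a ?b"
          using ab by (intro Henstock_Kurzweil_Integration.integral_combine[symmetric] integrable_continuous_real cont) auto
        have "norm (integral {?a..?b} (\<lambda>u. G ?b - G u)) \<le> (r / 2) * (?b - ?a)"
        proof (rule integral_bound)
          show "continuous_on {?a..?b} (\<lambda>u. G ?b - G u)" using ab by (intro continuous_intros cont) auto
          fix u assume u: "u \<in> {?a..?b}"
          then have "?a \<le> u" "u \<le> ?b" by auto
          then have "dist ?b u < d" "u \<in> {0..1}" "?b \<in> {0..1}"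
            unfolding dist_real_def atLeastAtMost_iff using ab Nd by linarith+
          then have "dist (G ?b) (G u) < r / 2" by (intro d(2))
          then show "norm (G ?b - G u) \<le> r / 2" by (simp add: dist_real_def)
        qed (use ab in auto)
        moreover have "integral {?a..?b} (\<lambda>u. G ?b - G u) = G ?b / real N - ?I ?a ?b"
          using ab by (subst Henstock_Kurzweil_Integration.integral_diff) (auto intro!: integrable_continuous_real cont)
        ultimately have "\<bar>G ?b / real N - ?I ?a ?b\<bar> \<le> r / 2 / real N"
          unfolding ab(4) by simp
        moreover have "\<bar>(\<Sum>x = 1..k. G (real x / real N) / real N) - ?I 0 ?a\<bar> \<le> real k * (r / 2 / real N)"
          using Suc by simp
        moreover have "real (Suc k) * (r / 2 / real N) = real k * (r / 2 / real N) + r / 2 / real N"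
          by (simp only: of_nat_Suc distrib_right mult_1_left add.commute)
        moreover have "(\<Sum>x = 1..Suc k. G (real x / real N) / real N) = (\<Sum>x = 1..k. G (real x / real N) / real N) + G ?b / real N"
          by simp
        ultimately show ?case unfolding comb by linarith
      qed
      have "norm ((\<Sum>x = 1..N. G (real x / real N) / real N) - ?I 0 1) \<le> r / 2"
        using step[of N] Np by simp
      then show "norm ((\<Sum>x = 1..N. G (real x / real N) / real N) - ?I 0 1) < r" using r by simp
    qed
  qed
  have "(\<lambda>N. G 1 / real N) \<longlonglongrightarrow> 0"
    by (rule lim_const_over_n)
  from tendsto_diff[OF full this] have "(\<lambda>N. (\<Sum>x = 1..N. G (real x / real N) / real N) - G 1 / real N) \<longlonglongrightarrow> ?I 0 1"
    by simp
  moreover have "\<forall>\<^sub>F N in sequentially. (\<Sum>x = 1..N. G (real x / real N) / real N) - G 1 / real N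
     = (\<Sum>x\<in>sites N. G (real x / real N) / real N)"
    using eventually_gt_at_top[of 0]
  proof eventually_elim
    case (elim N)
    then obtain k where "N = Suc k" by (cases N) auto
    then show ?case by (simp add: sites_def)
  qed
  ultimately show ?thesis unfolding I by (rule Lim_transform_eventually)
qed

section \<open>Estimates at fixed system size\<close>

definition sampled_weight :: "nat \<Rightarrow> (real \<Rightarrow> real) \<Rightarrow> nat \<Rightarrow> real" where
  "sampled_weight N G x = G (real x / real N) / real N"

lemma empirical_pairing_linear_obs:
  "empirical_pairing N \<eta> G = linear_obs N (sampled_weight N G) \<eta>"
  unfolding empirical_pairing_def linear_obs_def sampled_weight_def
  by (simp add: sum_divide_distrib mult.commute)

lemma sampled_weight_l1:
  assumes "\<And>u. u \<in> {0..1} \<Longrightarrow> \<bar>G u\<bar> \<le> B"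
  shows "(\<Sum>x\<in>sites N. \<bar>sampled_weight N G x\<bar>) \<le> B"
proof (cases "N = 0")
  case True
  then show ?thesis using assms[of 0] by (simp add: sites_def)
next
  case False
  have "(\<Sum>x\<in>sites N. \<bar>sampled_weight N G x\<bar>) \<le> (\<Sum>x\<in>sites N. B / real N)"
  proof (rule sum_mono)
    fix x assume "x \<in> sites N"
    then have "real x / real N \<in> {0..1}" using False by (auto simp: sites_def divide_le_eq_1)
    from assms[OF this] show "\<bar>sampled_weight N G x\<bar> \<le> B / real N"
      unfolding sampled_weight_def by (simp add: divide_right_mono)
  qed
  also have "\<dots> = B * (real (N - 1) / real N)" by (simp add: card_sites)
  also have "\<dots> \<le> B * 1" using False assms[of 0] by (intro mult_left_mono) auto
  finally show ?thesis by simp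
qed

text \<open>\<open>time_average_bound\<close> for the Robin solution divided by the acceleration factor; \<open>I\<close> is the candidate
for the limit of the stationary pairing.\<close>

lemma fast_boundary_bound:
  fixes N :: nat and c \<theta> \<alpha> \<beta> \<gamma> B t I :: real and X :: "real \<Rightarrow> 'w \<Rightarrow> config"
  assumes mc: "finite_ctmc (configs N) (gen_accelerated c \<theta> \<alpha> \<beta> \<gamma> N) C \<mu> M X"
    and N: "N \<ge> 4" and c: "c > 0" and ab: "0 < \<alpha>" "\<alpha> < 1" "0 < \<beta>" "\<beta> < 1" and t: "0 \<le> t"
    and B: "\<And>u. u \<in> {0..1} \<Longrightarrow> \<bar>G u\<bar> \<le> B"
  defines "\<kappa> \<equiv> c * real N powr (- \<theta>)"
  shows "integral\<^sup>L M (\<lambda>\<omega>. \<bar>LBINT s:{0..t}. empirical_pairing N (X s \<omega>) G - I\<bar>)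
    \<le> sqrt (4 * t * (3 * B * (real N * (B * (2 / \<kappa> + 3 * real N)) / real N powr (2 + \<gamma>))))
      + t * \<bar>(\<Sum>x\<in>sites N. sampled_weight N G x * stationary_profile \<kappa> \<alpha> \<beta> N x) - I\<bar>"
proof -
  interpret finite_ctmc "configs N" "gen_accelerated c \<theta> \<alpha> \<beta> \<gamma> N" C \<mu> M X by (rule mc)
  let ?g = "sampled_weight N G"
  let ?K = "real N powr (2 + \<gamma>)"
  let ?C = "\<Sum>x\<in>sites N. ?g x * stationary_profile \<kappa> \<alpha> \<beta> N x"
  have \<kappa>: "\<kappa> > 0" and K: "?K > 0" using c N by (auto simp: \<kappa>_def)
  have B0: "0 \<le> B" using B[of 0] by auto
  note l1 = sampled_weight_l1[of G B N, OF B]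
  obtain h where h:
    "\<And>\<eta>. \<eta> \<in> configs N \<Longrightarrow> gen_ssep c \<theta> \<alpha> \<beta> N (linear_obs N h) \<eta> = linear_obs N ?g \<eta> - ?C"
    "\<And>x. x \<in> sites N \<Longrightarrow> \<bar>h x\<bar> \<le> B * (2 / \<kappa> + 3 * real N)"
    using robin_poisson_solution[OF N c l1, of \<theta> \<alpha> \<beta>] unfolding \<kappa>_def by blast
  define F where "F = (\<lambda>\<xi>. 1 / ?K * linear_obs N h \<xi>)"
  have LF: "gen_accelerated c \<theta> \<alpha> \<beta> \<gamma> N F \<eta> = linear_obs N ?g \<eta> - ?C" if "\<eta> \<in> configs N" for \<eta>
    unfolding F_def gen_scaled h(1)[OF that] using K by simp
  have C: "\<bar>?C\<bar> \<le> 2 * B"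
  proof -
    have "\<bar>?C\<bar> \<le> (\<Sum>x\<in>sites N. \<bar>?g x\<bar> * 2)"
      using stationary_profile_le[OF _ \<kappa> ab]
      by (intro order_trans[OF sum_abs sum_mono]) (auto simp: abs_mult intro!: mult_left_mono)
    also have "\<dots> \<le> B * 2" using l1 by (simp add: sum_distrib_right[symmetric])
    finally show ?thesis by simp
  qed
  show ?thesis
  proof (rule time_average_bound[OF t, where F = F])
    fix \<eta> assume \<eta>: "\<eta> \<in> configs N"
    have "\<bar>linear_obs N h \<eta>\<bar> \<le> real N * (B * (2 / \<kappa> + 3 * real N))"
      using B0 \<kappa> by (intro linear_obs_le[OF \<eta> h(2)] mult_nonneg_nonneg) auto
    then show "\<bar>F \<eta>\<bar> \<le> real N * (B * (2 / \<kappa> + 3 * real N)) / ?K"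
      unfolding F_def using K by (simp add: abs_mult divide_right_mono)
    show "\<bar>gen_accelerated c \<theta> \<alpha> \<beta> \<gamma> N F \<eta>\<bar> \<le> 3 * B"
      unfolding LF[OF \<eta>] using C linear_obs_l1[OF \<eta>, of ?g] l1 by linarith
    show "\<bar>gen_accelerated c \<theta> \<alpha> \<beta> \<gamma> N F \<eta> - (empirical_pairing N \<eta> G - I)\<bar> \<le> \<bar>?C - I\<bar>"
      unfolding LF[OF \<eta>] empirical_pairing_linear_obs by linarith
  qed
qed

text \<open>At a single time the mean density is close to the solution of the relaxation equation started at
\<open>m\<^sub>0\<close>: \<open>\<delta>\<close> bounds its distance from the corrected mass, and \<open>relaxation_second_moment\<close> controls the
latter by the initial error and the generator errors \<open>\<epsilon>'\<close>.\<close>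

lemma slow_boundary_mass:
  fixes N :: nat and c \<theta> \<alpha> \<beta> \<gamma> \<nu> t m\<^sub>0 :: real and X :: "real \<Rightarrow> 'w \<Rightarrow> config"
  assumes mc: "finite_ctmc (configs N) (gen_accelerated c \<theta> \<alpha> \<beta> \<gamma> N) C \<mu> M X"
    and N: "N \<ge> 2" and c: "c > 0" and ab: "0 < \<alpha>" "\<alpha> < 1" "0 < \<beta>" "\<beta> < 1"
    and \<nu>: "0 \<le> \<nu>" and m0: "m\<^sub>0 \<in> {0..1}" and s: "0 \<le> s" "s \<le> t"
  defines "\<kappa> \<equiv> c * real N powr (- \<theta>)"
  defines "K \<equiv> real N powr (2 + \<gamma>)"
  defines "\<delta> \<equiv> 3 * \<kappa> * real N"
  defines "\<epsilon> \<equiv> \<bar>\<nu> - 2 * K * \<kappa> / (real N - 1)\<bar> + \<nu> * \<delta>"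
  defines "\<epsilon>' \<equiv> 2 * (1 + \<delta>) * \<epsilon> + K * (9 * \<kappa>\<^sup>2 * real N + 2 * \<kappa>) / (real N - 1)\<^sup>2"
  defines "k \<equiv> m\<^sub>0 - (\<alpha> + \<beta>) / 2"
  shows "integral\<^sup>L M (\<lambda>\<omega>. \<bar>mean_density N (X s \<omega>) - ((\<alpha> + \<beta>) / 2 + k * exp (- \<nu> * s))\<bar>)
    \<le> \<delta> + sqrt ((1 + 2 * \<delta>) * measure_pmf.expectation \<mu> (\<lambda>\<xi>. \<bar>mean_density N \<xi> - m\<^sub>0\<bar>) + \<delta>\<^sup>2
          + t * \<epsilon>' * (1 + 2 * \<bar>k\<bar>))"
proof -
  interpret finite_ctmc "configs N" "gen_accelerated c \<theta> \<alpha> \<beta> \<gamma> N" C \<mu> M X by (rule mc)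
  define Q where "Q = linear_obs N (corrected_weight \<kappa> N)"
  define f where "f = (\<lambda>\<xi>. Q \<xi> - (\<alpha> + \<beta>) / 2)"
  have \<kappa>: "\<kappa> > 0" and K: "K > 0" using c N by (auto simp: \<kappa>_def K_def)
  have \<delta>: "\<delta> \<ge> 0" unfolding \<delta>_def using \<kappa> by simp
  have \<epsilon>: "0 \<le> \<epsilon>" unfolding \<epsilon>_def using \<delta> \<nu> by simp
  have Qm: "\<bar>Q \<eta> - mean_density N \<eta>\<bar> \<le> \<delta>" if "\<eta> \<in> configs N" for \<eta>
    using corrected_mass(2)[OF N c that, of \<theta>] unfolding Q_def \<delta>_def \<kappa>_def .
  have "1 * \<epsilon> \<le> 2 * (1 + \<delta>) * \<epsilon>" using \<delta> \<epsilon> by (intro mult_right_mono) auto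
  moreover have "0 \<le> K * (9 * \<kappa>\<^sup>2 * real N + 2 * \<kappa>) / (real N - 1)\<^sup>2" using K \<kappa> by simp
  ultimately have \<epsilon>\<epsilon>': "\<epsilon> \<le> \<epsilon>'" unfolding \<epsilon>'_def by linarith
  have rel: "\<bar>gen_accelerated c \<theta> \<alpha> \<beta> \<gamma> N f \<eta> + \<nu> * f \<eta>\<bar> \<le> \<epsilon>'"
    "\<bar>gen_accelerated c \<theta> \<alpha> \<beta> \<gamma> N (\<lambda>\<xi>. (f \<xi>)\<^sup>2) \<eta> + 2 * \<nu> * (f \<eta>)\<^sup>2\<bar> \<le> \<epsilon>'"
    if "\<eta> \<in> configs N" for \<eta>
    using corrected_mass_relaxation[OF N c ab that \<nu>, where \<theta> = \<theta> and \<gamma> = \<gamma>] \<epsilon>\<epsilon>'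
    unfolding f_def Q_def \<epsilon>'_def \<epsilon>_def \<delta>_def K_def \<kappa>_def by (auto intro: order_trans)
  have init: "expectation (\<lambda>\<omega>. (f (X 0 \<omega>) - k)\<^sup>2)
    \<le> (1 + 2 * \<delta>) * measure_pmf.expectation \<mu> (\<lambda>\<xi>. \<bar>mean_density N \<xi> - m\<^sub>0\<bar>) + \<delta>\<^sup>2"
  proof -
    have fin: "finite (set_pmf \<mu>)" using initial finite_configs by (rule finite_subset)
    have "(f \<eta> - k)\<^sup>2 \<le> (1 + 2 * \<delta>) * \<bar>mean_density N \<eta> - m\<^sub>0\<bar> + \<delta>\<^sup>2" if \<eta>: "\<eta> \<in> configs N" for \<eta>
    proof -
      define y where "y = \<bar>mean_density N \<eta> - m\<^sub>0\<bar>"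
      have y: "0 \<le> y" "y \<le> 1"
        using mean_density_bounds[OF N \<eta>] m0 unfolding y_def by auto
      have "\<bar>f \<eta> - k\<bar> \<le> y + \<delta>"
      proof -
        have "f \<eta> - k = (Q \<eta> - mean_density N \<eta>) + (mean_density N \<eta> - m\<^sub>0)" by (simp add: f_def k_def)
        then show ?thesis using Qm[OF \<eta>] unfolding y_def by linarith
      qed
      then have "(f \<eta> - k)\<^sup>2 \<le> (y + \<delta>)\<^sup>2"
        using y \<delta> by (intro power2_le_iff_abs_le[THEN iffD2]) auto
      also have "\<dots> = y * y + 2 * \<delta> * y + \<delta>\<^sup>2" by (simp add: power2_eq_square algebra_simps)
      also have "\<dots> \<le> 1 * y + 2 * \<delta> * y + \<delta>\<^sup>2" using y by (intro add_right_mono mult_right_mono) auto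
      finally show ?thesis unfolding y_def by (simp add: distrib_right)
    qed
    then have "measure_pmf.expectation \<mu> (\<lambda>\<xi>. (f \<xi> - k)\<^sup>2)
      \<le> measure_pmf.expectation \<mu> (\<lambda>\<xi>. (1 + 2 * \<delta>) * \<bar>mean_density N \<xi> - m\<^sub>0\<bar> + \<delta>\<^sup>2)"
      using initial by (intro integral_mono_AE integrable_measure_pmf_finite fin) (auto simp: AE_measure_pmf_iff)
    also have "\<dots> = (1 + 2 * \<delta>) * measure_pmf.expectation \<mu> (\<lambda>\<xi>. \<bar>mean_density N \<xi> - m\<^sub>0\<bar>) + \<delta>\<^sup>2"
      by (subst Bochner_Integration.integral_add) (auto intro!: integrable_measure_pmf_finite fin)
    finally show ?thesis using initial_law[of "\<lambda>\<xi>. (f \<xi> - k)\<^sup>2"] by simp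
  qed
  have "expectation (\<lambda>\<omega>. (f (X s \<omega>) - k * exp (- \<nu> * s))\<^sup>2)
      \<le> expectation (\<lambda>\<omega>. (f (X 0 \<omega>) - k)\<^sup>2) + s * \<epsilon>' * (1 + 2 * \<bar>k\<bar>)"
    by (rule relaxation_second_moment[OF \<nu> s(1) rel])
  also have "s * \<epsilon>' * (1 + 2 * \<bar>k\<bar>) \<le> t * \<epsilon>' * (1 + 2 * \<bar>k\<bar>)"
    using s \<epsilon> \<epsilon>\<epsilon>' by (intro mult_right_mono) auto
  finally have sm: "expectation (\<lambda>\<omega>. (f (X s \<omega>) - k * exp (- \<nu> * s))\<^sup>2)
      \<le> (1 + 2 * \<delta>) * measure_pmf.expectation \<mu> (\<lambda>\<xi>. \<bar>mean_density N \<xi> - m\<^sub>0\<bar>) + \<delta>\<^sup>2 + t * \<epsilon>' * (1 + 2 * \<bar>k\<bar>)"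
    using init by linarith
  have l1: "expectation (\<lambda>\<omega>. \<bar>f (X s \<omega>) - k * exp (- \<nu> * s)\<bar>) \<le> sqrt
      ((1 + 2 * \<delta>) * measure_pmf.expectation \<mu> (\<lambda>\<xi>. \<bar>mean_density N \<xi> - m\<^sub>0\<bar>) + \<delta>\<^sup>2 + t * \<epsilon>' * (1 + 2 * \<bar>k\<bar>))"
    using obs_integrable[OF s(1), of "\<lambda>\<xi>. f \<xi> - k * exp (- \<nu> * s)"]
      obs_integrable[OF s(1), of "\<lambda>\<xi>. (f \<xi> - k * exp (- \<nu> * s))\<^sup>2"]
    by (intro abs_expectation_le_sqrt sm)
  have "expectation (\<lambda>\<omega>. \<bar>mean_density N (X s \<omega>) - ((\<alpha> + \<beta>) / 2 + k * exp (- \<nu> * s))\<bar>)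
     \<le> expectation (\<lambda>\<omega>. \<delta> + \<bar>f (X s \<omega>) - k * exp (- \<nu> * s)\<bar>)"
  proof (rule integral_mono)
    show "integrable M (\<lambda>\<omega>. \<bar>mean_density N (X s \<omega>) - ((\<alpha> + \<beta>) / 2 + k * exp (- \<nu> * s))\<bar>)"
      using obs_integrable[OF s(1), of "\<lambda>\<xi>. \<bar>mean_density N \<xi> - ((\<alpha> + \<beta>) / 2 + k * exp (- \<nu> * s))\<bar>"] .
    show "integrable M (\<lambda>\<omega>. \<delta> + \<bar>f (X s \<omega>) - k * exp (- \<nu> * s)\<bar>)"
      using obs_integrable[OF s(1), of "\<lambda>\<xi>. \<delta> + \<bar>f \<xi> - k * exp (- \<nu> * s)\<bar>"] .
    fix \<omega> assume "\<omega> \<in> space M"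
    from Qm[OF X_in_S[OF s(1) this]]
    show "\<bar>mean_density N (X s \<omega>) - ((\<alpha> + \<beta>) / 2 + k * exp (- \<nu> * s))\<bar> \<le> \<delta> + \<bar>f (X s \<omega>) - k * exp (- \<nu> * s)\<bar>"
      unfolding f_def by linarith
  qed
  also have "\<dots> = \<delta> + expectation (\<lambda>\<omega>. \<bar>f (X s \<omega>) - k * exp (- \<nu> * s)\<bar>)"
    using obs_integrable[OF s(1), of "\<lambda>\<xi>. \<bar>f \<xi> - k * exp (- \<nu> * s)\<bar>"]
    by (subst Bochner_Integration.integral_add) (auto simp: prob_space)
  finally show ?thesis using l1 by linarith
qed

lemma slow_boundary_fluctuation:
  fixes N :: nat and c \<theta> \<alpha> \<beta> \<gamma> A t :: real and X :: "real \<Rightarrow> 'w \<Rightarrow> config"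
  assumes mc: "finite_ctmc (configs N) (gen_accelerated c \<theta> \<alpha> \<beta> \<gamma> N) C \<mu> M X"
    and N: "N \<ge> 2" and c: "c > 0" and ab: "0 < \<beta>" "\<beta> < 1" and t: "0 \<le> t"
    and A: "(\<Sum>x\<in>sites N. \<bar>g x\<bar>) \<le> A" and g: "(\<Sum>x\<in>sites N. g x) = 0"
  defines "\<epsilon> \<equiv> c * real N powr (- \<theta>) * (real N * A)"
  shows "integral\<^sup>L M (\<lambda>\<omega>. \<bar>LBINT s:{0..t}. linear_obs N g (X s \<omega>)\<bar>)
    \<le> sqrt (4 * t * ((A + \<epsilon>) * (real N * (real N * A) / real N powr (2 + \<gamma>)))) + t * \<epsilon>"
proof -
  interpret finite_ctmc "configs N" "gen_accelerated c \<theta> \<alpha> \<beta> \<gamma> N" C \<mu> M X by (rule mc)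
  let ?K = "real N powr (2 + \<gamma>)"
  have K: "?K > 0" using N by auto
  have A0: "0 \<le> A" using A sum_nonneg[of "sites N" "\<lambda>x. \<bar>g x\<bar>"] by linarith
  obtain h where h:
    "\<And>\<eta>. \<eta> \<in> configs N \<Longrightarrow> \<bar>gen_ssep c \<theta> \<alpha> \<beta> N (linear_obs N h) \<eta> - linear_obs N g \<eta>\<bar> \<le> \<epsilon>"
    "\<And>x. x \<in> sites N \<Longrightarrow> \<bar>h x\<bar> \<le> real N * A"
    using neumann_poisson_solution[OF N c ab A g, of \<theta> \<alpha>] unfolding \<epsilon>_def by blast
  define F where "F = (\<lambda>\<xi>. 1 / ?K * linear_obs N h \<xi>)"
  have LF: "gen_accelerated c \<theta> \<alpha> \<beta> \<gamma> N F \<eta> = gen_ssep c \<theta> \<alpha> \<beta> N (linear_obs N h) \<eta>" for \<eta>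
    unfolding F_def gen_scaled using K by simp
  show ?thesis
  proof (rule time_average_bound[OF t, where F = F])
    fix \<eta> assume \<eta>: "\<eta> \<in> configs N"
    have "\<bar>linear_obs N h \<eta>\<bar> \<le> real N * (real N * A)"
      using A0 by (intro linear_obs_le[OF \<eta> h(2)]) auto
    then show "\<bar>F \<eta>\<bar> \<le> real N * (real N * A) / ?K"
      unfolding F_def using K by (simp add: abs_mult divide_right_mono)
    show "\<bar>gen_accelerated c \<theta> \<alpha> \<beta> \<gamma> N F \<eta>\<bar> \<le> A + \<epsilon>"
      unfolding LF using h(1)[OF \<eta>] linear_obs_l1[OF \<eta>, of g] A by linarith
    show "\<bar>gen_accelerated c \<theta> \<alpha> \<beta> \<gamma> N F \<eta> - linear_obs N g \<eta>\<bar> \<le> \<epsilon>"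
      unfolding LF using h(1)[OF \<eta>] .
  qed
qed

text \<open>The weight of the test function is split into its mean, which sees the mass only and is controlled
at single times by \<open>D\<close>, and a remainder of mean zero, which is controlled by
\<open>slow_boundary_fluctuation\<close>.\<close>

lemma slow_boundary_bound:
  fixes N :: nat and c \<theta> \<alpha> \<beta> \<gamma> B D I t :: real and X :: "real \<Rightarrow> 'w \<Rightarrow> config"
  assumes mc: "finite_ctmc (configs N) (gen_accelerated c \<theta> \<alpha> \<beta> \<gamma> N) C \<mu> M X"
    and N: "N \<ge> 2" and c: "c > 0" and ab: "0 < \<alpha>" "\<alpha> < 1" "0 < \<beta>" "\<beta> < 1" and t: "0 \<le> t"
    and B: "\<And>u. u \<in> {0..1} \<Longrightarrow> \<bar>G u\<bar> \<le> B"
    and r: "r \<in> borel_measurable borel" "\<And>s. s \<in> {0..t} \<Longrightarrow> \<bar>r s\<bar> \<le> Br"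
    and D: "\<And>s. s \<in> {0..t} \<Longrightarrow> integral\<^sup>L M (\<lambda>\<omega>. \<bar>mean_density N (X s \<omega>) - r s\<bar>) \<le> D"
  defines "\<epsilon> \<equiv> c * real N powr (- \<theta>) * (real N * (2 * B))"
  shows "integral\<^sup>L M (\<lambda>\<omega>. \<bar>LBINT s:{0..t}. empirical_pairing N (X s \<omega>) G - r s * I\<bar>)
    \<le> sqrt (4 * t * ((2 * B + \<epsilon>) * (real N * (real N * (2 * B)) / real N powr (2 + \<gamma>)))) + t * \<epsilon>
      + t * (\<bar>(\<Sum>x\<in>sites N. sampled_weight N G x) - I\<bar> + \<bar>I\<bar> * D)"
proof -
  interpret finite_ctmc "configs N" "gen_accelerated c \<theta> \<alpha> \<beta> \<gamma> N" C \<mu> M X by (rule mc)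
  let ?g = "sampled_weight N G"
  define R where "R = (\<Sum>x\<in>sites N. ?g x)"
  define g where "g x = ?g x - R / real (N - 1)" for x
  have m: "real (N - 1) > 0" using N by simp
  note l1 = sampled_weight_l1[of G B N, OF B]
  have R: "\<bar>R\<bar> \<le> B" unfolding R_def using sum_abs[of ?g "sites N"] l1 by linarith
  have g0: "(\<Sum>x\<in>sites N. g x) = 0"
    unfolding g_def sum_subtractf R_def[symmetric] using m by (simp add: card_sites)
  have g1: "(\<Sum>x\<in>sites N. \<bar>g x\<bar>) \<le> 2 * B"
  proof -
    have "(\<Sum>x\<in>sites N. \<bar>g x\<bar>) \<le> (\<Sum>x\<in>sites N. \<bar>?g x\<bar> + \<bar>R\<bar> / real (N - 1))"
    proof (rule sum_mono)
      fix x
      show "\<bar>g x\<bar> \<le> \<bar>?g x\<bar> + \<bar>R\<bar> / real (N - 1)"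
        unfolding g_def using abs_triangle_ineq4[of "?g x" "R / real (N - 1)"] by simp
    qed
    also have "\<dots> = (\<Sum>x\<in>sites N. \<bar>?g x\<bar>) + \<bar>R\<bar>"
      unfolding sum.distrib using m by (simp add: card_sites)
    finally show ?thesis using l1 R by linarith
  qed
  have split: "empirical_pairing N \<eta> G = linear_obs N g \<eta> + R * mean_density N \<eta>" for \<eta>
    unfolding empirical_pairing_linear_obs mean_density_linear_obs linear_obs_def g_def
    by (simp add: sum_distrib_left sum.distrib[symmetric] left_diff_distrib)
  define Y where "Y = (\<lambda>\<omega>. LBINT s:{0..t}. linear_obs N g (X s \<omega>))"
  define Z where "Z = (\<lambda>\<omega>. LBINT s:{0..t}. R * mean_density N (X s \<omega>) - r s * I)"
  have rm: "(\<lambda>s. r s * I) \<in> borel_measurable (horizon t)"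
    using r(1) by (intro measurable_restrict_space1) simp
  have ri: "integrable (horizon t) (\<lambda>s. r s * I)"
  proof (rule finite_measure.integrable_const_bound[OF finite_horizon, of _ "Br * \<bar>I\<bar>"])
    show "AE s in horizon t. norm (r s * I) \<le> Br * \<bar>I\<bar>"
      using r(2) by (intro AE_I2) (auto simp: abs_mult intro!: mult_right_mono)
  qed (rule rm)
  have YZ: "(LBINT s:{0..t}. empirical_pairing N (X s \<omega>) G - r s * I) = Y \<omega> + Z \<omega>" if "\<omega> \<in> space M" for \<omega>
  proof -
    have *: "(LBINT s:{0..t}. h (X s \<omega>) - r' s) = (\<integral>s. h (X (max 0 s) \<omega>) \<partial>horizon t) - (\<integral>s. r' s \<partial>horizon t)"
      if "integrable (horizon t) r'" for h :: "config \<Rightarrow> real" and r'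
    proof -
      have "(LBINT s:{0..t}. h (X s \<omega>) - r' s) = (\<integral>s. h (X (max 0 s) \<omega>) - r' s \<partial>horizon t)"
        unfolding set_integral_horizon by (intro Bochner_Integration.integral_cong) auto
      then show ?thesis using path_integrable[OF \<open>\<omega> \<in> space M\<close>, of t h] that by simp
    qed
    have "(LBINT s:{0..t}. empirical_pairing N (X s \<omega>) G - r s * I)
      = (\<integral>s. linear_obs N g (X (max 0 s) \<omega>) + R * mean_density N (X (max 0 s) \<omega>) \<partial>horizon t) - (\<integral>s. r s * I \<partial>horizon t)"
      unfolding split by (rule *[OF ri])
    also have "\<dots> = (\<integral>s. linear_obs N g (X (max 0 s) \<omega>) \<partial>horizon t)
        + ((\<integral>s. R * mean_density N (X (max 0 s) \<omega>) \<partial>horizon t) - (\<integral>s. r s * I \<partial>horizon t))"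
      using path_integrable[OF that, of t "linear_obs N g"] path_integrable[OF that, of t "\<lambda>\<xi>. R * mean_density N \<xi>"] by simp
    also have "\<dots> = Y \<omega> + Z \<omega>"
      unfolding Y_def Z_def time_integral_max[of t "linear_obs N g"]
      using *[OF ri, of "\<lambda>\<xi>. R * mean_density N \<xi>"] by simp
    finally show ?thesis .
  qed
  have Yi: "integrable M Y" unfolding Y_def using t by blast
  have Zi: "integrable M Z"
  proof -
    have "Z \<omega> = (LBINT s:{0..t}. R * mean_density N (X s \<omega>)) - (\<integral>s. r s * I \<partial>horizon t)" if "\<omega> \<in> space M" for \<omega>
    proof -
      have "Z \<omega> = (\<integral>s. R * mean_density N (X (max 0 s) \<omega>) - r s * I \<partial>horizon t)"
        unfolding Z_def set_integral_horizon by (intro Bochner_Integration.integral_cong) auto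
      then show ?thesis
        unfolding time_integral_max[of t "\<lambda>\<xi>. R * mean_density N \<xi>"]
        using path_integrable[OF that, of t "\<lambda>\<xi>. R * mean_density N \<xi>"] ri by simp
    qed
    moreover have "integrable M (\<lambda>\<omega>. (LBINT s:{0..t}. R * mean_density N (X s \<omega>)) - (\<integral>s. r s * I \<partial>horizon t))"
      using time_integral_integrable[OF t, of "\<lambda>\<xi>. R * mean_density N \<xi>"] by simp
    ultimately show ?thesis by (simp cong: Bochner_Integration.integrable_cong)
  qed
  have Y1: "expectation (\<lambda>\<omega>. \<bar>Y \<omega>\<bar>)
    \<le> sqrt (4 * t * ((2 * B + \<epsilon>) * (real N * (real N * (2 * B)) / real N powr (2 + \<gamma>)))) + t * \<epsilon>"
    unfolding Y_def \<epsilon>_def by (rule slow_boundary_fluctuation[OF mc N c ab(3,4) t g1 g0])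
  have Z1: "expectation (\<lambda>\<omega>. \<bar>Z \<omega>\<bar>) \<le> t * (\<bar>R - I\<bar> + \<bar>I\<bar> * D)"
    unfolding Z_def
  proof (rule time_integral_abs_le[OF t, where f = "\<lambda>\<xi>. R * mean_density N \<xi>" and Bh = "Br * \<bar>I\<bar>"])
    show "(\<lambda>s. r s * I) \<in> borel_measurable borel" using r(1) by simp
    fix s assume s: "s \<in> {0..t}"
    then have s0: "0 \<le> s" by simp
    show "\<bar>r s * I\<bar> \<le> Br * \<bar>I\<bar>" using r(2)[OF s] by (simp add: abs_mult mult_right_mono)
    have "expectation (\<lambda>\<omega>. \<bar>R * mean_density N (X s \<omega>) - r s * I\<bar>)
      \<le> expectation (\<lambda>\<omega>. \<bar>R - I\<bar> + \<bar>I\<bar> * \<bar>mean_density N (X s \<omega>) - r s\<bar>)"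
    proof (rule integral_mono)
      show "integrable M (\<lambda>\<omega>. \<bar>R * mean_density N (X s \<omega>) - r s * I\<bar>)"
        using obs_integrable[OF s0, of "\<lambda>\<xi>. \<bar>R * mean_density N \<xi> - r s * I\<bar>"] .
      show "integrable M (\<lambda>\<omega>. \<bar>R - I\<bar> + \<bar>I\<bar> * \<bar>mean_density N (X s \<omega>) - r s\<bar>)"
        using obs_integrable[OF s0, of "\<lambda>\<xi>. \<bar>R - I\<bar> + \<bar>I\<bar> * \<bar>mean_density N \<xi> - r s\<bar>"] .
      fix \<omega> assume "\<omega> \<in> space M"
      then have "X s \<omega> \<in> configs N" by (rule X_in_S[OF s0])
      note md = mean_density_bounds[OF N this]
      have "R * mean_density N (X s \<omega>) - r s * I = (R - I) * mean_density N (X s \<omega>) + I * (mean_density N (X s \<omega>) - r s)"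
        by (simp add: algebra_simps)
      moreover have "\<bar>(R - I) * mean_density N (X s \<omega>)\<bar> \<le> \<bar>R - I\<bar>"
        unfolding abs_mult using md by (simp add: mult_left_le)
      ultimately show "\<bar>R * mean_density N (X s \<omega>) - r s * I\<bar> \<le> \<bar>R - I\<bar> + \<bar>I\<bar> * \<bar>mean_density N (X s \<omega>) - r s\<bar>"
        using abs_triangle_ineq[of "(R - I) * mean_density N (X s \<omega>)" "I * (mean_density N (X s \<omega>) - r s)"]
        by (simp add: abs_mult)
    qed
    also have "\<dots> = \<bar>R - I\<bar> + \<bar>I\<bar> * expectation (\<lambda>\<omega>. \<bar>mean_density N (X s \<omega>) - r s\<bar>)"
      using obs_integrable[OF s0, of "\<lambda>\<xi>. \<bar>mean_density N \<xi> - r s\<bar>"]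
      by (subst Bochner_Integration.integral_add) (auto simp: prob_space)
    also have "\<dots> \<le> \<bar>R - I\<bar> + \<bar>I\<bar> * D"
      using D[OF s] by (intro add_left_mono mult_left_mono) auto
    finally show "expectation (\<lambda>\<omega>. \<bar>R * mean_density N (X s \<omega>) - r s * I\<bar>) \<le> \<bar>R - I\<bar> + \<bar>I\<bar> * D" .
  qed
  have "expectation (\<lambda>\<omega>. \<bar>LBINT s:{0..t}. empirical_pairing N (X s \<omega>) G - r s * I\<bar>)
      \<le> expectation (\<lambda>\<omega>. \<bar>Y \<omega>\<bar> + \<bar>Z \<omega>\<bar>)"
    using Yi Zi YZ by (intro integral_mono_AE') (auto intro!: AE_I2)
  also have "\<dots> = expectation (\<lambda>\<omega>. \<bar>Y \<omega>\<bar>) + expectation (\<lambda>\<omega>. \<bar>Z \<omega>\<bar>)"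
    using Yi Zi by simp
  finally show ?thesis using Y1 Z1 unfolding R_def by linarith
qed

section \<open>The limits of large systems\<close>

text \<open>The three regimes come from \<open>\<kappa> * N = c * N powr (1 - \<theta>)\<close>, which tends to infinity, to \<open>c\<close> or
to \<open>0\<close>.\<close>

lemma robin_coefficient_limits:
  fixes c \<theta> :: real
  assumes c: "c > 0"
  defines "\<kappa> \<equiv> \<lambda>N::nat. c * real N powr (- \<theta>)"
  shows "(\<lambda>N. \<kappa> N * real N / (2 + \<kappa> N * (real N - 2)))
      \<longlonglongrightarrow> (if \<theta> < 1 then 1 else if \<theta> = 1 then c / (2 + c) else 0)" (is ?q)
    and "(\<lambda>N. (1 + \<kappa> N * (real N - 1)) / (2 + \<kappa> N * (real N - 2)))
      \<longlonglongrightarrow> (if \<theta> < 1 then 1 else if \<theta> = 1 then (1 + c) / (2 + c) else 1 / 2)" (is ?p)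
proof -
  consider "\<theta> < 1" | "\<theta> = 1" | "\<theta> > 1" by linarith
  then have "?q \<and> ?p"
  proof cases
    case 1
    have "(\<lambda>N::nat. c * real N powr (- \<theta>) * real N / (2 + c * real N powr (- \<theta>) * (real N - 2))) \<longlonglongrightarrow> 1"
      "(\<lambda>N::nat. (1 + c * real N powr (- \<theta>) * (real N - 1)) / (2 + c * real N powr (- \<theta>) * (real N - 2))) \<longlonglongrightarrow> 1"
      using c 1 by real_asymp+
    then show ?thesis using 1 by (simp add: \<kappa>_def)
  next
    case 2
    have "(\<lambda>N::nat. c * real N powr (- 1) * real N / (2 + c * real N powr (- 1) * (real N - 2))) \<longlonglongrightarrow> c / (2 + c)"
      "(\<lambda>N::nat. (1 + c * real N powr (- 1) * (real N - 1)) / (2 + c * real N powr (- 1) * (real N - 2))) \<longlonglongrightarrow> (1 + c) / (2 + c)"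
      using c by (real_asymp simp: divide_inverse)+
    then show ?thesis using 2 by (simp add: \<kappa>_def)
  next
    case 3
    have "(\<lambda>N::nat. c * real N powr (- \<theta>) * real N / (2 + c * real N powr (- \<theta>) * (real N - 2))) \<longlonglongrightarrow> 0"
      "(\<lambda>N::nat. (1 + c * real N powr (- \<theta>) * (real N - 1)) / (2 + c * real N powr (- \<theta>) * (real N - 2))) \<longlonglongrightarrow> 1 / 2"
      using c 3 by real_asymp+
    then show ?thesis using 3 by (simp add: \<kappa>_def)
  qed
  then show ?q ?p by auto
qed

text \<open>The stationary profile is affine in \<open>x / N\<close>, so two Riemann sums, for \<open>G\<close> and for \<open>\<lambda>u. u * G u\<close>, and
the limits of its two coefficients suffice.\<close>

lemma stationary_pairing_limit:
  fixes c \<theta> \<alpha> \<beta> \<gamma> m\<^sub>0 s :: real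
  assumes c: "c > 0" and fast: "\<theta> \<le> 1 \<or> \<gamma> > \<theta> - 1" and G: "continuous_on {0..1} G"
  shows "(\<lambda>N. \<Sum>x\<in>sites N. sampled_weight N G x * stationary_profile (c * real N powr (- \<theta>)) \<alpha> \<beta> N x)
    \<longlonglongrightarrow> (LBINT u:{0..1}. profile c \<theta> \<alpha> \<beta> \<gamma> m\<^sub>0 s u * G u)"
proof -
  define \<kappa> where "\<kappa> = (\<lambda>N::nat. c * real N powr (- \<theta>))"
  define q where "q = (if \<theta> < 1 then 1 else if \<theta> = 1 then c / (2 + c) else 0)"
  define p where "p = (if \<theta> < 1 then 1 else if \<theta> = 1 then (1 + c) / (2 + c) else 1 / 2)"
  define I0 where "I0 = (LBINT u:{0..1}. G u)"
  define I1 where "I1 = (LBINT u:{0..1}. u * G u)"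
  have G1: "continuous_on {0..1} (\<lambda>u. u * G u)" using G by (intro continuous_intros)
  have int: "set_integrable lborel {0..1} G" "set_integrable lborel {0..1} (\<lambda>u. u * G u)"
    using borel_integrable_atLeastAtMost'[OF G] borel_integrable_atLeastAtMost'[OF G1] .
  have R0: "(\<lambda>N. \<Sum>x\<in>sites N. sampled_weight N G x) \<longlonglongrightarrow> I0"
    unfolding sampled_weight_def I0_def by (rule riemann_sum_sites[OF G])
  have R1: "(\<lambda>N. \<Sum>x\<in>sites N. sampled_weight N G x * (real x / real N)) \<longlonglongrightarrow> I1"
    using riemann_sum_sites[OF G1] unfolding sampled_weight_def I1_def by (simp add: mult_ac)
  have lims: "(\<lambda>N. \<kappa> N * real N / (2 + \<kappa> N * (real N - 2))) \<longlonglongrightarrow> q"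
    "(\<lambda>N. (1 + \<kappa> N * (real N - 1)) / (2 + \<kappa> N * (real N - 2))) \<longlonglongrightarrow> p"
    using robin_coefficient_limits[OF c, of \<theta>] unfolding \<kappa>_def q_def p_def by auto
  have "(\<lambda>N. \<beta> * (\<Sum>x\<in>sites N. sampled_weight N G x)
      - (\<beta> - \<alpha>) * ((1 + \<kappa> N * (real N - 1)) / (2 + \<kappa> N * (real N - 2)) * (\<Sum>x\<in>sites N. sampled_weight N G x)
        - \<kappa> N * real N / (2 + \<kappa> N * (real N - 2)) * (\<Sum>x\<in>sites N. sampled_weight N G x * (real x / real N))))
     \<longlonglongrightarrow> \<beta> * I0 - (\<beta> - \<alpha>) * (p * I0 - q * I1)"
    by (intro tendsto_intros R0 R1 lims)
  moreover have "\<forall>\<^sub>F N in sequentially. \<beta> * (\<Sum>x\<in>sites N. sampled_weight N G x)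
      - (\<beta> - \<alpha>) * ((1 + \<kappa> N * (real N - 1)) / (2 + \<kappa> N * (real N - 2)) * (\<Sum>x\<in>sites N. sampled_weight N G x)
        - \<kappa> N * real N / (2 + \<kappa> N * (real N - 2)) * (\<Sum>x\<in>sites N. sampled_weight N G x * (real x / real N)))
      = (\<Sum>x\<in>sites N. sampled_weight N G x * stationary_profile (\<kappa> N) \<alpha> \<beta> N x)"
    using eventually_gt_at_top[of 0]
  proof eventually_elim
    case (elim N)
    define P where "P = (1 + \<kappa> N * (real N - 1)) / (2 + \<kappa> N * (real N - 2))"
    define D where "D = \<kappa> N * real N / (2 + \<kappa> N * (real N - 2))"
    have sp: "stationary_profile (\<kappa> N) \<alpha> \<beta> N x = \<beta> - (\<beta> - \<alpha>) * (P - D * (real x / real N))" for x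
    proof -
      have "1 + \<kappa> N * (real N - 1 - real x) = (1 + \<kappa> N * (real N - 1)) - \<kappa> N * real N * (real x / real N)"
        using elim by (simp add: algebra_simps)
      then show ?thesis unfolding stationary_profile_def P_def D_def by (simp only: diff_divide_distrib times_divide_eq_left)
    qed
    have "(\<Sum>x\<in>sites N. sampled_weight N G x * stationary_profile (\<kappa> N) \<alpha> \<beta> N x)
      = (\<Sum>x\<in>sites N. \<beta> * sampled_weight N G x - (\<beta> - \<alpha>) * (P * sampled_weight N G x
          - D * (sampled_weight N G x * (real x / real N))))"
      unfolding sp by (intro sum.cong refl) (simp add: algebra_simps)
    also have "\<dots> = \<beta> * (\<Sum>x\<in>sites N. sampled_weight N G x)
      - (\<beta> - \<alpha>) * (P * (\<Sum>x\<in>sites N. sampled_weight N G x)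
        - D * (\<Sum>x\<in>sites N. sampled_weight N G x * (real x / real N)))"
      by (simp only: sum_subtractf sum_distrib_left[symmetric])
    finally show ?case unfolding P_def D_def by simp
  qed
  ultimately have lim: "(\<lambda>N. \<Sum>x\<in>sites N. sampled_weight N G x * stationary_profile (\<kappa> N) \<alpha> \<beta> N x)
     \<longlonglongrightarrow> \<beta> * I0 - (\<beta> - \<alpha>) * (p * I0 - q * I1)"
    by (rule Lim_transform_eventually)
  have prof: "profile c \<theta> \<alpha> \<beta> \<gamma> m\<^sub>0 s u = \<beta> - (\<beta> - \<alpha>) * (p - q * u)" for u
  proof -
    consider "\<theta> < 1" | "\<theta> = 1" | "\<theta> > 1" "\<gamma> > \<theta> - 1" using fast by linarith
    then show ?thesis
    proof cases
      case 2
      then have "profile c \<theta> \<alpha> \<beta> \<gamma> m\<^sub>0 s u = c * (\<beta> - \<alpha>) / (2 + c) * u + \<alpha> + (\<beta> - \<alpha>) / (2 + c)"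
        by (simp add: profile_def)
      also have "\<dots> = \<beta> - (\<beta> - \<alpha>) * ((1 + c) / (2 + c) - c / (2 + c) * u)"
        using c by (simp add: divide_simps) (simp add: algebra_simps)
      finally show ?thesis using 2 by (simp add: p_def q_def)
    qed (simp_all add: profile_def p_def q_def algebra_simps, simp add: field_simps)
  qed
  have "(LBINT u:{0..1}. profile c \<theta> \<alpha> \<beta> \<gamma> m\<^sub>0 s u * G u)
      = (LBINT u:{0..1}. (\<beta> - (\<beta> - \<alpha>) * p) * G u + (\<beta> - \<alpha>) * q * (u * G u))"
    unfolding prof by (simp add: algebra_simps)
  also have "\<dots> = (\<beta> - (\<beta> - \<alpha>) * p) * I0 + (\<beta> - \<alpha>) * q * I1"
    unfolding I0_def I1_def using int by (subst set_integral_add(2)) auto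
  also have "\<dots> = \<beta> * I0 - (\<beta> - \<alpha>) * (p * I0 - q * I1)" by (simp add: algebra_simps)
  finally show ?thesis using lim unfolding \<kappa>_def by simp
qed

text \<open>With \<open>K = N powr (2 + \<gamma>)\<close> the three sequences have orders \<open>N powr (1 - \<theta>)\<close>, \<open>N powr (1 + \<gamma> - \<theta>)\<close>
and \<open>N powr (1 + \<gamma> - 2 * \<theta>) + N powr (\<gamma> - \<theta>)\<close>; the second limit is the macroscopic relaxation
rate.\<close>

lemma corrected_mass_error_limits:
  fixes c \<theta> \<gamma> :: real
  assumes c: "c > 0" and \<theta>: "\<theta> > 1" and \<gamma>: "\<gamma> \<le> \<theta> - 1"
  shows "(\<lambda>N::nat. 3 * (c * real N powr (- \<theta>)) * real N) \<longlonglongrightarrow> 0"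
    and "(\<lambda>N::nat. 2 * real N powr (2 + \<gamma>) * (c * real N powr (- \<theta>)) / (real N - 1))
      \<longlonglongrightarrow> (if \<gamma> < \<theta> - 1 then 0 else 2 * c)"
    and "(\<lambda>N::nat. real N powr (2 + \<gamma>) * (9 * (c * real N powr (- \<theta>))\<^sup>2 * real N
        + 2 * (c * real N powr (- \<theta>))) / (real N - 1)\<^sup>2) \<longlonglongrightarrow> 0"
proof -
  show "(\<lambda>N::nat. 3 * (c * real N powr (- \<theta>)) * real N) \<longlonglongrightarrow> 0"
    using c \<theta> by real_asymp
  show "(\<lambda>N::nat. 2 * real N powr (2 + \<gamma>) * (c * real N powr (- \<theta>)) / (real N - 1))
      \<longlonglongrightarrow> (if \<gamma> < \<theta> - 1 then 0 else 2 * c)"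
  proof (cases "\<gamma> < \<theta> - 1")
    case True
    then have "(\<lambda>N::nat. 2 * real N powr (2 + \<gamma>) * (c * real N powr (- \<theta>)) / (real N - 1)) \<longlonglongrightarrow> 0"
      using c by real_asymp
    with True show ?thesis by simp
  next
    case False
    have "(\<lambda>N::nat. 2 * real N powr (2 + (\<theta> - 1)) * (c * real N powr (- \<theta>)) / (real N - 1)) \<longlonglongrightarrow> 2 * c"
      using c by real_asymp
    with False \<gamma> show ?thesis by (simp add: antisym)
  qed
  show "(\<lambda>N::nat. real N powr (2 + \<gamma>) * (9 * (c * real N powr (- \<theta>))\<^sup>2 * real N
        + 2 * (c * real N powr (- \<theta>))) / (real N - 1)\<^sup>2) \<longlonglongrightarrow> 0"
    using c \<theta> \<gamma> by real_asymp
qed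

lemma robin_bound_limit:
  fixes c \<theta> \<gamma> B :: real
  assumes c: "c > 0" and \<gamma>: "\<gamma> > 0" "\<gamma> > \<theta> - 1"
  shows "(\<lambda>N::nat. real N * (B * (2 / (c * real N powr (- \<theta>)) + 3 * real N)) / real N powr (2 + \<gamma>)) \<longlonglongrightarrow> 0"
proof -
  have "(\<lambda>N::nat. real N * (2 / (c * real N powr (- \<theta>))) / real N powr (2 + \<gamma>)) \<longlonglongrightarrow> 0"
    using c \<gamma>(2) by real_asymp
  moreover have "(\<lambda>N::nat. real N * (3 * real N) / real N powr (2 + \<gamma>)) \<longlonglongrightarrow> 0"
    using \<gamma>(1) by real_asymp
  ultimately have "(\<lambda>N::nat. B * (real N * (2 / (c * real N powr (- \<theta>))) / real N powr (2 + \<gamma>)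
     + real N * (3 * real N) / real N powr (2 + \<gamma>))) \<longlonglongrightarrow> B * (0 + 0)"
    by (intro tendsto_intros)
  then show ?thesis by (simp add: algebra_simps add_divide_distrib)
qed

theorem theorem2p3:
  fixes c \<theta> \<alpha> \<beta> \<gamma> m\<^sub>0 :: real
    and \<mu> :: "nat \<Rightarrow> config pmf"
    and M :: "nat \<Rightarrow> 'w measure"
    and \<eta> :: "nat \<Rightarrow> real \<Rightarrow> 'w \<Rightarrow> config"
    and G :: "real \<Rightarrow> real"
    and t :: real
  assumes "c > 0" and "\<theta> \<ge> 0"
    and "0 < \<alpha>" and "\<alpha> < 1" and "0 < \<beta>" and "\<beta> < 1"
    and "\<gamma> > 0"
    and "\<And>N. N \<ge> 2 \<Longrightarrow> set_pmf (\<mu> N) \<subseteq> configs N"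
    and "\<theta> > 1 \<Longrightarrow> \<gamma> \<le> \<theta> - 1 \<Longrightarrow> m\<^sub>0 \<in> {0..1}"
    and "\<theta> > 1 \<Longrightarrow> \<gamma> \<le> \<theta> - 1 \<Longrightarrow>
           (\<lambda>N. measure_pmf.expectation (\<mu> N) (\<lambda>\<xi>. \<bar>mean_density N \<xi> - m\<^sub>0\<bar>)) \<longlonglongrightarrow> 0"
    and "\<And>N. N \<ge> 2 \<Longrightarrow>
           ctmc (configs N) (gen_accelerated c \<theta> \<alpha> \<beta> \<gamma> N) (\<mu> N) (M N) (\<eta> N)"
    and "t > 0"
    and "continuous_on {0..1} G"
  shows "(\<lambda>N. integral\<^sup>L (M N) (\<lambda>\<omega>.
            \<bar>LBINT s:{0..t}. (empirical_pairing N (\<eta> N s \<omega>) G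
               - (LBINT u:{0..1}. profile c \<theta> \<alpha> \<beta> \<gamma> m\<^sub>0 s u * G u))\<bar>)) \<longlonglongrightarrow> 0"
proof -
  note c = \<open>c > 0\<close> and ab = \<open>0 < \<alpha>\<close> \<open>\<alpha> < 1\<close> \<open>0 < \<beta>\<close> \<open>\<beta> < 1\<close>
  note G = \<open>continuous_on {0..1} G\<close>
  have t: "0 \<le> t" using \<open>t > 0\<close> by simp
  obtain B where B: "\<And>u. u \<in> {0..1} \<Longrightarrow> \<bar>G u\<bar> \<le> B"
    using compact_imp_bounded[OF compact_continuous_image[OF G compact_Icc]]
    unfolding bounded_iff by (metis imageI real_norm_def)
  define C where "C N = real N powr (2 + \<gamma>) * (2 * real (N - 2) + 4 * (c * real N powr (- \<theta>)))" for N
  have mc: "finite_ctmc (configs N) (gen_accelerated c \<theta> \<alpha> \<beta> \<gamma> N) (C N) (\<mu> N) (M N) (\<eta> N)" if "N \<ge> 2" for N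
    unfolding C_def using finite_generator_ssep[OF that c ab] assms(8,11)[OF that]
    by (simp add: finite_ctmc_def finite_ctmc_axioms_def)
  let ?E = "\<lambda>N. integral\<^sup>L (M N) (\<lambda>\<omega>. \<bar>LBINT s:{0..t}. (empirical_pairing N (\<eta> N s \<omega>) G
               - (LBINT u:{0..1}. profile c \<theta> \<alpha> \<beta> \<gamma> m\<^sub>0 s u * G u))\<bar>)"
  have squeeze: "?E \<longlonglongrightarrow> 0" if "\<forall>\<^sub>F N in sequentially. ?E N \<le> b N" "b \<longlonglongrightarrow> 0" for b
    by (rule tendsto_sandwich[of "\<lambda>_. 0" ?E sequentially b]) (use that in auto)
  show ?thesis
  proof (cases "\<theta> \<le> 1 \<or> \<gamma> > \<theta> - 1")
    case fast: True
    with \<open>\<gamma> > 0\<close> have \<gamma>: "\<gamma> > \<theta> - 1" by auto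
    define I where "I = (LBINT u:{0..1}. profile c \<theta> \<alpha> \<beta> \<gamma> m\<^sub>0 0 u * G u)"
    have prof: "(LBINT u:{0..1}. profile c \<theta> \<alpha> \<beta> \<gamma> m\<^sub>0 s u * G u) = I" for s
    proof -
      have "profile c \<theta> \<alpha> \<beta> \<gamma> m\<^sub>0 s = profile c \<theta> \<alpha> \<beta> \<gamma> m\<^sub>0 0"
        using fast by (auto simp: profile_def)
      then show ?thesis unfolding I_def by simp
    qed
    have E: "?E N = integral\<^sup>L (M N) (\<lambda>\<omega>. \<bar>LBINT s:{0..t}. empirical_pairing N (\<eta> N s \<omega>) G - I\<bar>)" for N
      unfolding prof ..
    show ?thesis
    proof (rule squeeze)
      show "\<forall>\<^sub>F N in sequentially. ?E N
        \<le> sqrt (4 * t * (3 * B * (real N * (B * (2 / (c * real N powr (- \<theta>)) + 3 * real N)) / real N powr (2 + \<gamma>))))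
          + t * \<bar>(\<Sum>x\<in>sites N. sampled_weight N G x * stationary_profile (c * real N powr (- \<theta>)) \<alpha> \<beta> N x) - I\<bar>"
        using eventually_ge_at_top[of 4]
      proof eventually_elim
        case (elim N)
        then show ?case unfolding E by (intro fast_boundary_bound[OF mc] c ab t B) auto
      qed
      have l1: "(\<lambda>N. sqrt (4 * t * (3 * B * (real N * (B * (2 / (c * real N powr (- \<theta>)) + 3 * real N)) / real N powr (2 + \<gamma>)))))
         \<longlonglongrightarrow> sqrt (4 * t * (3 * B * 0))"
        by (intro tendsto_intros robin_bound_limit c \<gamma> \<open>\<gamma> > 0\<close>)
      have l2: "(\<lambda>N. t * \<bar>(\<Sum>x\<in>sites N. sampled_weight N G x * stationary_profile (c * real N powr (- \<theta>)) \<alpha> \<beta> N x) - I\<bar>)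
         \<longlonglongrightarrow> t * \<bar>I - I\<bar>"
        unfolding I_def by (intro tendsto_intros stationary_pairing_limit c fast G)
      show "(\<lambda>N. sqrt (4 * t * (3 * B * (real N * (B * (2 / (c * real N powr (- \<theta>)) + 3 * real N)) / real N powr (2 + \<gamma>))))
          + t * \<bar>(\<Sum>x\<in>sites N. sampled_weight N G x * stationary_profile (c * real N powr (- \<theta>)) \<alpha> \<beta> N x) - I\<bar>) \<longlonglongrightarrow> 0"
        using tendsto_add[OF l1 l2] by simp
    qed
  next
    case False
    then have \<theta>: "\<theta> > 1" and \<gamma>: "\<gamma> \<le> \<theta> - 1" by auto
    note m0 = assms(9)[OF \<theta> \<gamma>] and init = assms(10)[OF \<theta> \<gamma>]
    define \<nu> where "\<nu> = (if \<gamma> < \<theta> - 1 then 0 else 2 * c)"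
    define k where "k = m\<^sub>0 - (\<alpha> + \<beta>) / 2"
    define r where "r s = (\<alpha> + \<beta>) / 2 + k * exp (- \<nu> * s)" for s
    define I where "I = (LBINT u:{0..1}. G u)"
    have \<nu>: "0 \<le> \<nu>" using c by (simp add: \<nu>_def)
    have prof: "profile c \<theta> \<alpha> \<beta> \<gamma> m\<^sub>0 s u = r s" for s u
      using \<theta> \<gamma> by (auto simp: profile_def r_def k_def \<nu>_def)
    have E: "?E N = integral\<^sup>L (M N) (\<lambda>\<omega>. \<bar>LBINT s:{0..t}. empirical_pairing N (\<eta> N s \<omega>) G - r s * I\<bar>)" for N
      unfolding prof I_def by simp
    have r: "r \<in> borel_measurable borel" unfolding r_def by measurable
    have rb: "\<bar>r s\<bar> \<le> (\<alpha> + \<beta>) / 2 + \<bar>k\<bar>" if "s \<in> {0..t}" for s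
    proof -
      have "exp (- \<nu> * s) \<le> 1" using \<nu> that by simp
      then have "\<bar>k * exp (- \<nu> * s)\<bar> \<le> \<bar>k\<bar>" by (simp add: abs_mult mult_left_le)
      then show ?thesis
        unfolding r_def using ab abs_triangle_ineq[of "(\<alpha> + \<beta>) / 2" "k * exp (- \<nu> * s)"] by simp
    qed
    define \<delta> where "\<delta> N = 3 * (c * real N powr (- \<theta>)) * real N" for N
    define e where "e N = measure_pmf.expectation (\<mu> N) (\<lambda>\<xi>. \<bar>mean_density N \<xi> - m\<^sub>0\<bar>)" for N
    define \<epsilon> where "\<epsilon> N = 2 * (1 + \<delta> N) * (\<bar>\<nu> - 2 * real N powr (2 + \<gamma>) * (c * real N powr (- \<theta>)) / (real N - 1)\<bar> + \<nu> * \<delta> N)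
      + real N powr (2 + \<gamma>) * (9 * (c * real N powr (- \<theta>))\<^sup>2 * real N + 2 * (c * real N powr (- \<theta>))) / (real N - 1)\<^sup>2" for N
    define D where "D N = \<delta> N + sqrt ((1 + 2 * \<delta> N) * e N + (\<delta> N)\<^sup>2 + t * \<epsilon> N * (1 + 2 * \<bar>k\<bar>))" for N
    define w where "w N = c * real N powr (- \<theta>) * (real N * (2 * B))" for N
    note lims = corrected_mass_error_limits[OF c \<theta> \<gamma>, folded \<nu>_def]
    have \<delta>0: "\<delta> \<longlonglongrightarrow> 0" unfolding \<delta>_def by (rule lims(1))
    have "\<epsilon> \<longlonglongrightarrow> 2 * (1 + 0) * (\<bar>\<nu> - \<nu>\<bar> + \<nu> * 0) + 0"
      unfolding \<epsilon>_def by (intro tendsto_intros \<delta>0 lims(2,3))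
    then have \<epsilon>0: "\<epsilon> \<longlonglongrightarrow> 0" by simp
    have "D \<longlonglongrightarrow> 0 + sqrt ((1 + 2 * 0) * 0 + 0\<^sup>2 + t * 0 * (1 + 2 * \<bar>k\<bar>))"
      unfolding D_def by (intro tendsto_intros \<delta>0 \<epsilon>0 init[folded e_def])
    then have D0: "D \<longlonglongrightarrow> 0" by simp
    have "(\<lambda>N. 2 * B / 3 * \<delta> N) \<longlonglongrightarrow> 2 * B / 3 * 0" by (intro tendsto_intros \<delta>0)
    then have w0: "w \<longlonglongrightarrow> 0" unfolding w_def \<delta>_def by (simp add: mult_ac)
    show ?thesis
    proof (rule squeeze)
      show "\<forall>\<^sub>F N in sequentially. ?E N
        \<le> sqrt (4 * t * ((2 * B + w N) * (real N * (real N * (2 * B)) / real N powr (2 + \<gamma>)))) + t * w N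
          + t * (\<bar>(\<Sum>x\<in>sites N. sampled_weight N G x) - I\<bar> + \<bar>I\<bar> * D N)"
        using eventually_ge_at_top[of 2]
      proof eventually_elim
        case (elim N)
        have "integral\<^sup>L (M N) (\<lambda>\<omega>. \<bar>mean_density N (\<eta> N s \<omega>) - r s\<bar>) \<le> D N" if "s \<in> {0..t}" for s
          unfolding r_def k_def D_def e_def \<epsilon>_def \<delta>_def
          using that by (intro slow_boundary_mass[OF mc[OF elim] elim c ab \<nu> m0]) auto
        then show ?case
          unfolding E w_def by (intro slow_boundary_bound[OF mc[OF elim] elim c ab t, where Br = "(\<alpha> + \<beta>) / 2 + \<bar>k\<bar>"] B r rb)
      qed
      have "(\<lambda>N::nat. real N * (real N * 1) / real N powr (2 + \<gamma>)) \<longlonglongrightarrow> 0"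
        using \<open>\<gamma> > 0\<close> by real_asymp
      then have "(\<lambda>N::nat. 2 * B * (real N * (real N * 1) / real N powr (2 + \<gamma>))) \<longlonglongrightarrow> 2 * B * 0"
        by (intro tendsto_intros)
      then have K0: "(\<lambda>N::nat. real N * (real N * (2 * B)) / real N powr (2 + \<gamma>)) \<longlonglongrightarrow> 0"
        by (simp add: mult_ac)
      have R0: "(\<lambda>N. \<Sum>x\<in>sites N. sampled_weight N G x) \<longlonglongrightarrow> I"
        unfolding sampled_weight_def I_def by (rule riemann_sum_sites[OF G])
      have "(\<lambda>N. sqrt (4 * t * ((2 * B + w N) * (real N * (real N * (2 * B)) / real N powr (2 + \<gamma>)))) + t * w N
          + t * (\<bar>(\<Sum>x\<in>sites N. sampled_weight N G x) - I\<bar> + \<bar>I\<bar> * D N))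
        \<longlonglongrightarrow> sqrt (4 * t * ((2 * B + 0) * 0)) + t * 0 + t * (\<bar>I - I\<bar> + \<bar>I\<bar> * 0)"
        by (intro tendsto_intros w0 K0 R0 D0)
      then show "(\<lambda>N. sqrt (4 * t * ((2 * B + w N) * (real N * (real N * (2 * B)) / real N powr (2 + \<gamma>)))) + t * w N
          + t * (\<bar>(\<Sum>x\<in>sites N. sampled_weight N G x) - I\<bar> + \<bar>I\<bar> * D N)) \<longlonglongrightarrow> 0"
        by simp
    qed
  qed
qed

end
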